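(* Let $(X,d_X)$ and $(Y,d_Y)$ be length spaces and let $d$ be a (finite dimensional) metric on $X\times Y$ with curvature bounded above and below. Let $\pi_X:X\times Y\to X$ and $\pi_Y:X\times Y\to Y$ be the projections. Then $d$ is the product metric if and only if $\pi_X:(X\times Y,d)\to(X,d_X)$ and $\pi_Y:(X\times Y,d)\to(Y,d_Y)$ are submetries such that for each $(x,y)\in X\times Y$, the restrictions $\pi_X:\pi_Y^{-1}(\pi_Y(x,y))\to X$ and $\pi_Y:\pi_X^{-1}(\pi_X(x,y))\to Y$ are isometries.
   Context: A map $\pi:X\to B$ between metric spaces is a submetry if for every $p\in X$ and $r>0$, the closed ball $B(p,r)$ is mapped by $\pi$ onto the closed ball $B(\pi(p),r)$. The product metric on $X\times Y$ is the metric $d$ with $d^2((x_1,y_1),(x_2,y_2))=d_X^2(x_1,x_2)+d_Y^2(y_1,y_2)$ for $x_i\in X$, $y_i\in Y$. Curvature bounds are in the sense of Alexandrov; Alexandrov spaces are assumed finite dimensional. Fibers carry the metric restricted from $d$. *)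

theory Defs
  imports "HOL-Analysis.Analysis"
begin

text \<open>
  A metric space is a carrier \<open>M\<close> with a distance function \<open>d\<close> satisfying the library locale
  \<^locale>\<open>Metric_space\<close>; a subset \<open>A\<close> of \<open>M\<close> with the restricted metric is \<open>A\<close> with the same \<open>d\<close>.
\<close>

section \<open>Length spaces\<close>

definition curve_length :: "('a \<Rightarrow> 'a \<Rightarrow> real) \<Rightarrow> (real \<Rightarrow> 'a) \<Rightarrow> ereal" where
  "curve_length d \<gamma> =
     (SUP (n, t) \<in> {(n :: nat, t :: nat \<Rightarrow> real). mono_on {..n} t \<and> t ` {..n} \<subseteq> {0..1}}.
        ereal (\<Sum>i<n. d (\<gamma> (t i)) (\<gamma> (t (Suc i)))))"

text \<open>
  The infimum over the empty set is \<open>\<infinity>\<close>, so any two points of a length space are joined by a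
  rectifiable curve.
\<close>

definition length_space :: "'a set \<Rightarrow> ('a \<Rightarrow> 'a \<Rightarrow> real) \<Rightarrow> bool" where
  "length_space M d \<longleftrightarrow> Metric_space M d \<and>
     (\<forall>x\<in>M. \<forall>y\<in>M.
        ereal (d x y) =
          (INF \<gamma> \<in> {\<gamma>. pathin (Metric_space.mtopology M d) \<gamma> \<and> \<gamma> 0 = x \<and> \<gamma> 1 = y}.
             curve_length d \<gamma>))"

section \<open>Hausdorff dimension\<close>

definition set_diameter :: "('a \<Rightarrow> 'a \<Rightarrow> real) \<Rightarrow> 'a set \<Rightarrow> ennreal" where
  "set_diameter d A = (SUP (x, y) \<in> A \<times> A. ennreal (d x y))"

definition hausdorff_premeasure :: "('a \<Rightarrow> 'a \<Rightarrow> real) \<Rightarrow> real \<Rightarrow> real \<Rightarrow> 'a set \<Rightarrow> ennreal" where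
  "hausdorff_premeasure d s \<delta> A =
     (INF U \<in> {U :: nat \<Rightarrow> 'a set.
                A = (\<Union>i. U i) \<and> (\<forall>i. set_diameter d (U i) \<le> ennreal \<delta>)}.
        \<Sum>i. ennreal (enn2real (set_diameter d (U i)) powr s))"

definition hausdorff_measure :: "('a \<Rightarrow> 'a \<Rightarrow> real) \<Rightarrow> real \<Rightarrow> 'a set \<Rightarrow> ennreal" where
  "hausdorff_measure d s A = (SUP \<delta> \<in> {0<..}. hausdorff_premeasure d s \<delta> A)"

text \<open>
  Only exponents \<open>s > 0\<close> are used, because \<open>0 powr 0 = 0\<close> would make the zero-dimensional
  measure wrong; this does not change the infimum.
\<close>

definition hausdorff_dimension :: "'a set \<Rightarrow> ('a \<Rightarrow> 'a \<Rightarrow> real) \<Rightarrow> ennreal" where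
  "hausdorff_dimension M d = (INF s \<in> {s :: real. s > 0 \<and> hausdorff_measure d s M = 0}. ennreal s)"

definition finite_dimensional :: "'a set \<Rightarrow> ('a \<Rightarrow> 'a \<Rightarrow> real) \<Rightarrow> bool" where
  "finite_dimensional M d \<longleftrightarrow> hausdorff_dimension M d < \<infinity>"

section \<open>The model planes of constant curvature\<close>

text \<open>
  The simply connected surface of constant curvature \<open>k\<close>: for \<open>k > 0\<close> the unit sphere with its
  angular metric divided by \<open>\<surd>k\<close>, for \<open>k = 0\<close> the Euclidean plane, and for \<open>k < 0\<close> the upper sheet of
  the hyperboloid in Minkowski space with the hyperbolic metric divided by \<open>\<surd>(-k)\<close>.
\<close>

type_synonym point3 = "real \<times> real \<times> real"

definition minkowski :: "point3 \<Rightarrow> point3 \<Rightarrow> real" where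
  "minkowski = (\<lambda>(a, b, c) (a', b', c'). a * a' + b * b' - c * c')"

definition model_plane :: "real \<Rightarrow> point3 set" where
  "model_plane k =
     (if k > 0 then {u. norm u = 1}
      else if k = 0 then {(a, b, c). c = 0}
      else {(a, b, c). minkowski (a, b, c) (a, b, c) = -1 \<and> c > 0})"

definition model_dist :: "real \<Rightarrow> point3 \<Rightarrow> point3 \<Rightarrow> real" where
  "model_dist k u v =
     (if k > 0 then arccos (u \<bullet> v) / sqrt k
      else if k = 0 then dist u v
      else arcosh (- minkowski u v) / sqrt (- k))"

section \<open>Curvature bounds in the sense of Alexandrov\<close>

definition geodesic_segment :: "'a set \<Rightarrow> ('a \<Rightarrow> 'a \<Rightarrow> real) \<Rightarrow> 'a \<Rightarrow> 'a \<Rightarrow> 'a set \<Rightarrow> bool" where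
  "geodesic_segment M d x y S \<longleftrightarrow>
     (\<exists>l \<gamma>. 0 \<le> l \<and> S = \<gamma> ` {0..l} \<and> S \<subseteq> M \<and> \<gamma> 0 = x \<and> \<gamma> l = y \<and>
        (\<forall>s\<in>{0..l}. \<forall>t\<in>{0..l}. d (\<gamma> s) (\<gamma> t) = \<bar>s - t\<bar>))"

text \<open>The bounds below are \<open>2D\<close> and \<open>D\<close>, where \<open>D = \<pi> / \<surd>k\<close> for \<open>k > 0\<close> and \<open>D = \<infinity>\<close> otherwise.\<close>

definition small_perimeter :: "real \<Rightarrow> ('a \<Rightarrow> 'a \<Rightarrow> real) \<Rightarrow> 'a \<Rightarrow> 'a \<Rightarrow> 'a \<Rightarrow> bool" where
  "small_perimeter k d x y z \<longleftrightarrow> (k > 0 \<longrightarrow> d x y + d y z + d z x < 2 * pi / sqrt k)"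

definition small_distance :: "real \<Rightarrow> ('a \<Rightarrow> 'a \<Rightarrow> real) \<Rightarrow> 'a \<Rightarrow> 'a \<Rightarrow> bool" where
  "small_distance k d x y \<longleftrightarrow> (k > 0 \<longrightarrow> d x y < pi / sqrt k)"

text \<open>
  \<open>x' y' z'\<close> is a comparison triangle in the model plane, and \<open>p'\<close>, \<open>q'\<close> are the comparison points
  of \<open>p\<close> on the side from \<open>x\<close> to \<open>y\<close> and of \<open>q\<close> on the side from \<open>x\<close> to \<open>z\<close>.
\<close>

definition comparison_points ::
  "real \<Rightarrow> ('a \<Rightarrow> 'a \<Rightarrow> real) \<Rightarrow> 'a \<Rightarrow> 'a \<Rightarrow> 'a \<Rightarrow> 'a \<Rightarrow> 'a \<Rightarrow>
     point3 \<Rightarrow> point3 \<Rightarrow> point3 \<Rightarrow> point3 \<Rightarrow> point3 \<Rightarrow> bool" where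
  "comparison_points k d x y z p q x' y' z' p' q' \<longleftrightarrow>
     {x', y', z', p', q'} \<subseteq> model_plane k \<and>
     model_dist k x' y' = d x y \<and> model_dist k y' z' = d y z \<and> model_dist k z' x' = d z x \<and>
     model_dist k x' p' = d x p \<and> model_dist k p' y' = d p y \<and>
     model_dist k x' q' = d x q \<and> model_dist k q' z' = d q z"

text \<open>
  Comparison of all geodesic triangles in \<open>M\<close> with vertices in \<open>U\<close>. As \<open>x\<close>, \<open>y\<close>, \<open>z\<close> range over
  all triples, \<open>p\<close> and \<open>q\<close> range over all pairs of points on different sides.
\<close>

definition triangles_thin :: "real \<Rightarrow> 'a set \<Rightarrow> ('a \<Rightarrow> 'a \<Rightarrow> real) \<Rightarrow> 'a set \<Rightarrow> bool" where
  "triangles_thin k M d U \<longleftrightarrow>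
     (\<forall>x\<in>U. \<forall>y\<in>U. \<forall>z\<in>U. \<forall>S\<^sub>x\<^sub>y S\<^sub>y\<^sub>z S\<^sub>x\<^sub>z.
        small_perimeter k d x y z \<and> geodesic_segment M d x y S\<^sub>x\<^sub>y \<and>
        geodesic_segment M d y z S\<^sub>y\<^sub>z \<and> geodesic_segment M d x z S\<^sub>x\<^sub>z \<longrightarrow>
        (\<forall>p\<in>S\<^sub>x\<^sub>y. \<forall>q\<in>S\<^sub>x\<^sub>z. \<forall>x' y' z' p' q'.
           comparison_points k d x y z p q x' y' z' p' q' \<longrightarrow> d p q \<le> model_dist k p' q'))"

definition triangles_thick :: "real \<Rightarrow> 'a set \<Rightarrow> ('a \<Rightarrow> 'a \<Rightarrow> real) \<Rightarrow> 'a set \<Rightarrow> bool" where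
  "triangles_thick k M d U \<longleftrightarrow>
     (\<forall>x\<in>U. \<forall>y\<in>U. \<forall>z\<in>U. \<forall>S\<^sub>x\<^sub>y S\<^sub>y\<^sub>z S\<^sub>x\<^sub>z.
        small_perimeter k d x y z \<and> geodesic_segment M d x y S\<^sub>x\<^sub>y \<and>
        geodesic_segment M d y z S\<^sub>y\<^sub>z \<and> geodesic_segment M d x z S\<^sub>x\<^sub>z \<longrightarrow>
        (\<forall>p\<in>S\<^sub>x\<^sub>y. \<forall>q\<in>S\<^sub>x\<^sub>z. \<forall>x' y' z' p' q'.
           comparison_points k d x y z p q x' y' z' p' q' \<longrightarrow> model_dist k p' q' \<le> d p q))"

definition CAT :: "real \<Rightarrow> 'a set \<Rightarrow> ('a \<Rightarrow> 'a \<Rightarrow> real) \<Rightarrow> bool" where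
  "CAT k M d \<longleftrightarrow> Metric_space M d \<and>
     (\<forall>x\<in>M. \<forall>y\<in>M. small_distance k d x y \<longrightarrow> (\<exists>S. geodesic_segment M d x y S)) \<and>
     triangles_thin k M d M"

definition curvature_le :: "real \<Rightarrow> 'a set \<Rightarrow> ('a \<Rightarrow> 'a \<Rightarrow> real) \<Rightarrow> bool" where
  "curvature_le k M d \<longleftrightarrow> length_space M d \<and>
     (\<forall>p\<in>M. \<exists>r>0. CAT k (Metric_space.mball M d p r) d)"

definition curvature_ge :: "real \<Rightarrow> 'a set \<Rightarrow> ('a \<Rightarrow> 'a \<Rightarrow> real) \<Rightarrow> bool" where
  "curvature_ge k M d \<longleftrightarrow> length_space M d \<and>
     (\<forall>p\<in>M. \<exists>r>0.
        (\<forall>x\<in>Metric_space.mball M d p r. \<forall>y\<in>Metric_space.mball M d p r.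
           \<exists>S. geodesic_segment M d x y S) \<and>
        triangles_thick k M d (Metric_space.mball M d p r))"

definition curvature_bounded_above :: "'a set \<Rightarrow> ('a \<Rightarrow> 'a \<Rightarrow> real) \<Rightarrow> bool" where
  "curvature_bounded_above M d \<longleftrightarrow> (\<exists>k. curvature_le k M d)"

definition curvature_bounded_below :: "'a set \<Rightarrow> ('a \<Rightarrow> 'a \<Rightarrow> real) \<Rightarrow> bool" where
  "curvature_bounded_below M d \<longleftrightarrow> (\<exists>k. curvature_ge k M d)"

section \<open>Submetries and isometries\<close>

definition submetry ::
  "'a set \<Rightarrow> ('a \<Rightarrow> 'a \<Rightarrow> real) \<Rightarrow> 'b set \<Rightarrow> ('b \<Rightarrow> 'b \<Rightarrow> real) \<Rightarrow> ('a \<Rightarrow> 'b) \<Rightarrow> bool" where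
  "submetry X dX B dB f \<longleftrightarrow> f ` X \<subseteq> B \<and>
     (\<forall>p\<in>X. \<forall>r>0. f ` Metric_space.mcball X dX p r = Metric_space.mcball B dB (f p) r)"

definition isometry ::
  "'a set \<Rightarrow> ('a \<Rightarrow> 'a \<Rightarrow> real) \<Rightarrow> 'b set \<Rightarrow> ('b \<Rightarrow> 'b \<Rightarrow> real) \<Rightarrow> ('a \<Rightarrow> 'b) \<Rightarrow> bool" where
  "isometry A dA B dB f \<longleftrightarrow> bij_betw f A B \<and> (\<forall>p\<in>A. \<forall>q\<in>A. dB (f p) (f q) = dA p q)"

end

theory Submission
  imports Defs "HOL-Real_Asymp.Real_Asymp"
begin

text \<open>
  Fix two close points \<open>(x, y)\<close>, \<open>(x', y')\<close> and consider the
  rectangle they span, with sides \<open>a = d\<^sub>X x x'\<close> and \<open>b = d\<^sub>Y y y'\<close>. As the projection to \<open>X\<close> is short, no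
  point of the fibre over \<open>x\<close> is closer to \<open>(x', y)\<close> than the corner \<open>(x, y)\<close>, so the angle there is at
  least right, and thinness of triangles makes the square of each diagonal at least \<open>a\<^sup>2 + b\<^sup>2\<close> up to a
  factor \<open>1 + \<epsilon>\<close>. The quadrilateral inequality for thin triangles bounds the sum of the squares of the
  diagonals by \<open>2 (a\<^sup>2 + b\<^sup>2)\<close> up to such a factor, so both diagonals are almost as long as in the
  product. Hence \<open>d\<close> and the product metric agree infinitesimally, and being length metrics they are
  equal.
\<close>

section \<open>Comparison triangles in the model planes\<close>

text \<open>The local estimates need a relative error: along a chain of n short steps an additive
  error is multiplied by n, while a factor 1 + \<epsilon> passes through the sum. Since a rectangle
  may be long and narrow, this error has to be uniform in its shape, so the admissible size of a
  triangle may depend on k and \<epsilon> only. The quadrilateral inequality controls just the sum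
  of the squared diagonals. An upper bound for one diagonal therefore needs a lower bound for the
  other, so both are first bounded from below. No angle is ever defined in the space. The condition
  that no point of a side is closer to the opposite vertex than the corner stands in for it, and it
  passes to the comparison triangle because thinness makes the comparison distances at least as
  large. The final globalization is not symmetric. The metric \<open>d\<close> is a length metric by
  its curvature bound, so its own curves can be subdivided; for the product metric, chains are
  assembled from curves of the two factors.\<close>

lemma one_minus_cos_le: "1 - cos t \<le> t\<^sup>2 / 2" for t :: real
proof -
  have "1 - cos t = 2 * (sin (t / 2))\<^sup>2"
    using cos_double_sin[of "t / 2"] by simp
  moreover have "(sin (t / 2))\<^sup>2 \<le> (t / 2)\<^sup>2"
    using abs_sin_x_le_abs_x[of "t / 2"] abs_le_square_iff by blast
  ultimately show ?thesis by (simp add: power_divide)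
qed

lemma cosh_minus_one_ge: "t\<^sup>2 / 2 \<le> cosh t - 1" for t :: real
proof -
  have "cosh t - 1 = 2 * (sinh (t / 2))\<^sup>2"
    using cosh_double_cosh[of "t / 2"] by (simp add: cosh_square_eq)
  moreover have "(t / 2)\<^sup>2 \<le> (sinh (t / 2))\<^sup>2"
    using real_le_abs_sinh[of "t / 2", unfolded abs_le_square_iff]
    by (simp only: sinh_field_def exp_minus)
  ultimately show ?thesis by (simp add: power_divide)
qed

lemma cos_cosh_quadratic:
  fixes \<epsilon> :: real
  assumes "0 < \<epsilon>"
  obtains \<rho> where "0 < \<rho>" "\<rho> \<le> 1"
    "\<And>t. 0 \<le> t \<Longrightarrow> t \<le> \<rho> \<Longrightarrow> (1 - \<epsilon>) * t\<^sup>2 / 2 \<le> 1 - cos t"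
    "\<And>t. 0 \<le> t \<Longrightarrow> t \<le> \<rho> \<Longrightarrow> cosh t - 1 \<le> (1 + \<epsilon>) * t\<^sup>2 / 2"
    "\<And>t. 0 \<le> t \<Longrightarrow> t \<le> \<rho> \<Longrightarrow> 1 - \<epsilon> \<le> cos t"
proof -
  have "((\<lambda>t. (1 - cos t) / t\<^sup>2) \<longlongrightarrow> 1/2) (at_right (0::real))"
    by real_asymp
  then have 1: "eventually (\<lambda>t::real. (1 - \<epsilon>)/2 < (1 - cos t) / t\<^sup>2) (at_right 0)"
    by (rule order_tendstoD) (use assms in simp)
  have "((\<lambda>t. (cosh t - 1) / t\<^sup>2) \<longlongrightarrow> 1/2) (at_right (0::real))"
    by real_asymp
  then have 2: "eventually (\<lambda>t::real. (cosh t - 1) / t\<^sup>2 < (1 + \<epsilon>)/2) (at_right 0)"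
    by (rule order_tendstoD) (use assms in simp)
  have "((\<lambda>t. cos t) \<longlongrightarrow> 1) (at_right (0::real))" by real_asymp
  then have 3: "eventually (\<lambda>t::real. 1 - \<epsilon> < cos t) (at_right 0)"
    by (rule order_tendstoD) (use assms in simp)
  from eventually_conj[OF 1 eventually_conj[OF 2 3]]
  obtain b where b: "b > 0" "\<And>t. 0 < t \<Longrightarrow> t < b \<Longrightarrow> (1 - \<epsilon>)/2 < (1 - cos t) / t\<^sup>2"
    "\<And>t. 0 < t \<Longrightarrow> t < b \<Longrightarrow> (cosh t - 1) / t\<^sup>2 < (1 + \<epsilon>)/2"
    "\<And>t. 0 < t \<Longrightarrow> t < b \<Longrightarrow> 1 - \<epsilon> < cos t"
    unfolding eventually_at_right_field by blast
  show thesis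
  proof (rule that[of "min (b/2) 1"])
    fix t :: real assume t: "0 \<le> t" "t \<le> min (b/2) 1"
    show "(1 - \<epsilon>) * t\<^sup>2 / 2 \<le> 1 - cos t"
    proof (cases "t = 0")
      case False
      then have "(1 - \<epsilon>)/2 < (1 - cos t) / t\<^sup>2" using b(1) b(2)[of t] t by simp
      then show ?thesis using False by (simp add: pos_less_divide_eq)
    qed simp
    show "cosh t - 1 \<le> (1 + \<epsilon>) * t\<^sup>2 / 2"
    proof (cases "t = 0")
      case False
      then have "(cosh t - 1) / t\<^sup>2 < (1 + \<epsilon>)/2" using b(1) b(3)[of t] t by simp
      then show ?thesis using False by (simp add: pos_divide_less_eq)
    qed simp
    show "1 - \<epsilon> \<le> cos t"
    proof (cases "t = 0")
      case False
      then show ?thesis using b(1) b(4)[of t] t by simp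
    qed (use assms in simp)
  qed (use b(1) in auto)
qed

text \<open>A substitute for the first variation formula. It is applied with f a decreasing function
  of the distance from the vertex \<open>y'\<close> to the point at s on the opposite side; the
  derivative then gives the sign of the coordinate u of \<open>y'\<close> in the direction of that
  side, so u \<le> 0 says that the angle at \<open>x'\<close> is at least right.\<close>

lemma derivative_nonpos_at_right_max:
  fixes f :: "real \<Rightarrow> real"
  assumes "(f has_real_derivative u) (at 0)" "0 < c" "\<And>s. 0 \<le> s \<Longrightarrow> s \<le> c \<Longrightarrow> f s \<le> f 0"
  shows "u \<le> 0"
proof (rule ccontr)
  assume "\<not> u \<le> 0"
  then obtain e where e: "e > 0" "\<And>h. h > 0 \<Longrightarrow> h < e \<Longrightarrow> f 0 < f (0 + h)"
    using DERIV_pos_inc_right[OF assms(1)] by auto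
  define h where "h = min (e/2) c"
  have h: "0 < h" "h < e" "h \<le> c"
    using e(1) assms(2) by (auto simp: h_def min_def)
  have "f 0 < f h" using e(2)[OF h(1,2)] by simp
  moreover have "f h \<le> f 0" using assms(3) h by simp
  ultimately show False by simp
qed

text \<open>
  There is a comparison triangle \<open>x' y' z'\<close> with \<open>|x'y'| = a\<close>, \<open>|y'z'| = b\<close>, \<open>|z'x'| = c\<close>, whose side
  from \<open>x'\<close> to \<open>z'\<close> is \<open>q'\<close>, satisfying up to a factor \<open>1 + \<epsilon>\<close> two Euclidean facts: the length of the
  median from \<open>y'\<close>, and Pythagoras when no point of the side is closer to \<open>y'\<close> than \<open>x'\<close>, so that
  the angle at \<open>x'\<close> is at least right.
\<close>

definition almost_flat_comparison :: "real \<Rightarrow> real \<Rightarrow> real \<Rightarrow> real \<Rightarrow> real \<Rightarrow> bool" where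
  "almost_flat_comparison k \<epsilon> a b c \<longleftrightarrow>
     (\<exists>x' y' z' q'. {x', y', z'} \<subseteq> model_plane k \<and> q' ` {0..c} \<subseteq> model_plane k \<and>
        model_dist k x' y' = a \<and> model_dist k y' z' = b \<and> model_dist k z' x' = c \<and>
        model_dist k y' y' = 0 \<and>
        (\<forall>s\<in>{0..c}. model_dist k x' (q' s) = s \<and> model_dist k (q' s) z' = c - s) \<and>
        (model_dist k y' (q' (c / 2)))\<^sup>2 \<le> (1 + \<epsilon>) * (a\<^sup>2 + b\<^sup>2) / 2 - c\<^sup>2 / 4 \<and>
        ((\<forall>s\<in>{0..c}. a \<le> model_dist k y' (q' s)) \<longrightarrow> a\<^sup>2 + c\<^sup>2 \<le> (1 + \<epsilon>) * b\<^sup>2))"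

section \<open>Triangles in the Euclidean plane\<close>

lemma norm_point3: "norm (a, b, c) = sqrt (a\<^sup>2 + b\<^sup>2 + c\<^sup>2)" for a b c :: real
  by (simp add: norm_prod_def)

lemma almost_flat_comparison_euclidean:
  assumes "0 \<le> \<epsilon>" "0 \<le> a" "0 \<le> b" "0 < c" "a \<le> b + c" "b \<le> a + c" "c \<le> a + b"
  shows "almost_flat_comparison 0 \<epsilon> a b c"
proof -
  \<comment> \<open>Law of cosines: with \<open>x'\<close> at the origin and the side towards
    \<open>z'\<close> on the first axis, u is the first coordinate of \<open>y'\<close>. The
    triangle inequalities amount to \<bar>u\<bar> \<le> a, which makes room for the second
    coordinate v.\<close>
  define u where "u = (a\<^sup>2 + c\<^sup>2 - b\<^sup>2) / (2 * c)"
  have "a\<^sup>2 \<ge> u\<^sup>2"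
  proof -
    have "(c - a)\<^sup>2 \<le> b\<^sup>2" using assms by (intro abs_le_square_iff[THEN iffD1]) auto
    moreover have "b\<^sup>2 \<le> (a + c)\<^sup>2" using assms by (intro power_mono) auto
    ultimately have "\<bar>u\<bar> \<le> a"
      using assms by (simp add: u_def abs_le_iff pos_divide_le_eq pos_le_divide_eq power2_eq_square algebra_simps)
    then show ?thesis using assms abs_le_square_iff[of u a] by simp
  qed
  then obtain v where v: "v\<^sup>2 = a\<^sup>2 - u\<^sup>2"
    by (metis diff_ge_0_iff_ge real_sqrt_pow2)
  have u: "2 * (u * c) = a\<^sup>2 + c\<^sup>2 - b\<^sup>2" using assms by (simp add: u_def)
  define y' :: point3 where "y' = (u, v, 0)"
  define q' :: "real \<Rightarrow> point3" where "q' s = (s, 0, 0)" for s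
  have yq: "(model_dist 0 y' (q' s))\<^sup>2 = a\<^sup>2 - 2 * (u * s) + s\<^sup>2" for s
  proof -
    have "(model_dist 0 y' (q' s))\<^sup>2 = (u - s)\<^sup>2 + v\<^sup>2"
      by (simp add: model_dist_def y'_def q'_def dist_norm norm_point3)
    also have "\<dots> = u\<^sup>2 + v\<^sup>2 - 2 * (u * s) + s\<^sup>2"
      by (simp add: power2_diff)
    finally show ?thesis by (simp add: v)
  qed
  have qq: "model_dist 0 (q' s) (q' t) = \<bar>s - t\<bar>" for s t
    by (simp add: model_dist_def q'_def dist_norm norm_point3)
  have sym: "model_dist 0 p q = model_dist 0 q p" for p q
    by (simp add: model_dist_def dist_commute)
  have nn: "0 \<le> model_dist 0 p q" for p q
    by (simp add: model_dist_def)
  show ?thesis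
    unfolding almost_flat_comparison_def
  proof (rule exI[of _ "q' 0"], rule exI[of _ y'], rule exI[of _ "q' c"], rule exI[of _ q'],
      intro conjI ballI impI)
    show "model_dist 0 (q' 0) y' = a"
      using yq[of 0] nn assms by (simp add: sym[of "q' 0"])
    show "model_dist 0 y' (q' c) = b"
    proof -
      have "(model_dist 0 y' (q' c))\<^sup>2 = b\<^sup>2" using yq[of c] u by simp
      then show ?thesis using nn assms by (simp add: power2_eq_iff_nonneg)
    qed
    show "(model_dist 0 y' (q' (c / 2)))\<^sup>2 \<le> (1 + \<epsilon>) * (a\<^sup>2 + b\<^sup>2) / 2 - c\<^sup>2 / 4"
    proof -
      have "(a\<^sup>2 + b\<^sup>2) / 2 \<le> (1 + \<epsilon>) * (a\<^sup>2 + b\<^sup>2) / 2"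
        using assms mult_right_mono[of 1 "1 + \<epsilon>" "a\<^sup>2 + b\<^sup>2"] by simp
      moreover have "(model_dist 0 y' (q' (c / 2)))\<^sup>2 = a\<^sup>2 - u * c + c\<^sup>2 / 4"
        by (simp add: yq power_divide)
      then have "(model_dist 0 y' (q' (c / 2)))\<^sup>2 = (a\<^sup>2 + b\<^sup>2) / 2 - c\<^sup>2 / 4"
        using u by (simp add: field_simps)
      ultimately show ?thesis by (simp only: diff_right_mono)
    qed
    assume *: "\<forall>s\<in>{0..c}. a \<le> model_dist 0 y' (q' s)"
    have "2 * u \<le> 0"
    proof (rule derivative_nonpos_at_right_max)
      show "((\<lambda>s. 2 * (u * s) - s\<^sup>2) has_real_derivative 2 * u) (at 0)"
        by (auto intro!: derivative_eq_intros)
      fix s assume "0 \<le> s" "s \<le> c"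
      then have "a\<^sup>2 \<le> (model_dist 0 y' (q' s))\<^sup>2"
        using * assms by (intro power_mono) auto
      then show "2 * (u * s) - s\<^sup>2 \<le> 2 * (u * 0) - 0\<^sup>2" by (simp add: yq)
    qed (use assms in auto)
    then have "u * c \<le> 0" using assms by (simp add: mult_le_0_iff)
    then have "a\<^sup>2 + c\<^sup>2 \<le> b\<^sup>2" using u by linarith
    also have "\<dots> \<le> (1 + \<epsilon>) * b\<^sup>2" using assms by (simp add: mult_le_cancel_right1)
    finally show "a\<^sup>2 + c\<^sup>2 \<le> (1 + \<epsilon>) * b\<^sup>2" .
  qed (use assms in \<open>auto simp: model_plane_def y'_def q'_def qq[unfolded q'_def] \<close>,
       auto simp: model_dist_def)
qed

section \<open>Triangles on the sphere and on the hyperboloid\<close>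

text \<open>Provides the vertex (u, v, cos a) of a triangle whose other vertices are the pole (0, 0,
  1) and (sin c, 0, cos c). The first equation puts it on the unit sphere, the second is its inner
  product with the third vertex. A suitable v exists as soon as \<bar>u\<bar> \<le> sin a, which the
  addition formulas derive from cos (a + c) \<le> cos b \<le> cos (a - c).\<close>

lemma sphere_coordinates:
  fixes a b c :: real
  assumes "0 \<le> a" "0 \<le> b" "0 < c" "a \<le> b + c" "b \<le> a + c" "c \<le> a + b" "a + c \<le> pi"
  obtains u v where "u\<^sup>2 + v\<^sup>2 + (cos a)\<^sup>2 = 1" "cos a * cos c + u * sin c = cos b"
proof -
  show thesis
  proof (cases "c = pi")
    \<comment> \<open>The third vertex is antipodal to the pole and sin c = 0, so the second
      equation does not determine u; but then the vertex sought is the pole itself.\<close>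
    case True
    then have "a = 0" "b = pi" using assms by auto
    with True show thesis by (intro that[of 0 0]) auto
  next
    case False
    then have s: "0 < sin c" using assms by (intro sin_gt_zero) auto
    have sa: "0 \<le> sin a" using assms by (intro sin_ge_zero) auto
    define u where "u = (cos b - cos a * cos c) / sin c"
    have "cos (a + c) \<le> cos b" using assms by (intro cos_monotone_0_pi_le) auto
    moreover have "cos b \<le> cos \<bar>a - c\<bar>" using assms by (intro cos_monotone_0_pi_le) auto
    ultimately have "\<bar>u\<bar> \<le> sin a"
      using s by (auto simp: u_def abs_le_iff cos_add cos_diff cos_abs_real field_simps)
    then have "u\<^sup>2 \<le> (sin a)\<^sup>2" using sa abs_le_square_iff[of u "sin a"] by simp
    then obtain v where v: "v\<^sup>2 = (sin a)\<^sup>2 - u\<^sup>2"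
      by (metis diff_ge_0_iff_ge real_sqrt_pow2)
    show thesis
      by (rule that[of u v]) (use v s in \<open>auto simp: u_def\<close>)
  qed
qed

text \<open>The same construction from the apex (0, 0, 1) and (sinh c, 0, cosh c), with the negative
  of the Minkowski form in place of the inner product, whence the sign of u.\<close>

lemma hyperboloid_coordinates:
  fixes a b c :: real
  assumes "0 \<le> a" "0 \<le> b" "0 < c" "a \<le> b + c" "b \<le> a + c" "c \<le> a + b"
  obtains u v where "u\<^sup>2 + v\<^sup>2 + 1 = (cosh a)\<^sup>2" "cosh a * cosh c - u * sinh c = cosh b"
proof -
  have s: "0 < sinh c" using assms by simp
  have sa: "0 \<le> sinh a" using assms by simp
  define u where "u = (cosh a * cosh c - cosh b) / sinh c"
  have "cosh b \<le> cosh (a + c)" using assms by (subst cosh_real_nonneg_le_iff) auto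
  moreover have "cosh \<bar>a - c\<bar> \<le> cosh b" using assms by (subst cosh_real_nonneg_le_iff) auto
  ultimately have "\<bar>u\<bar> \<le> sinh a"
    using s by (auto simp: u_def abs_le_iff cosh_add cosh_diff field_simps)
  then have "u\<^sup>2 \<le> (sinh a)\<^sup>2" using sa abs_le_square_iff[of u "sinh a"] by simp
  then obtain v where v: "v\<^sup>2 = (sinh a)\<^sup>2 - u\<^sup>2"
    by (metis diff_ge_0_iff_ge real_sqrt_pow2)
  show thesis
    by (rule that[of u v]) (use v s in \<open>auto simp: u_def cosh_square_eq\<close>)
qed

text \<open>A factor 1 - \<delta> is lost when 1 - cos t is replaced by half the square of t, and
  another when a cosine in front is replaced by 1; this is why the square of 1 - \<delta> has to be
  absorbed by 1 + \<epsilon>. The bound \<rho> \<le> 1 keeps sums of two rescaled sides below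
  pi.\<close>

lemma almost_flat_comparison_spherical:
  fixes k \<epsilon> \<delta> \<rho> a b c :: real
  assumes k: "0 < k" and \<delta>: "0 < \<delta>" "\<delta> < 1" "1 \<le> (1 - \<delta>)\<^sup>2 * (1 + \<epsilon>)" "0 \<le> \<epsilon>" and \<rho>: "0 < \<rho>" "\<rho> \<le> 1"
    and quad: "\<And>t. 0 \<le> t \<Longrightarrow> t \<le> \<rho> \<Longrightarrow> (1 - \<delta>) * t\<^sup>2 / 2 \<le> 1 - cos t"
    and near: "\<And>t. 0 \<le> t \<Longrightarrow> t \<le> \<rho> \<Longrightarrow> 1 - \<delta> \<le> cos t"
    and tri: "0 \<le> a" "0 \<le> b" "0 < c" "a \<le> b + c" "b \<le> a + c" "c \<le> a + b"
    and small: "sqrt k * a \<le> \<rho>" "sqrt k * b \<le> \<rho>" "sqrt k * c \<le> \<rho>"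
  shows "almost_flat_comparison k \<epsilon> a b c"
proof -
  define \<kappa> where "\<kappa> = sqrt k"
  have \<kappa>: "0 < \<kappa>" using k by (auto simp: \<kappa>_def)
  define \<alpha> \<beta> \<gamma> where "\<alpha> = \<kappa> * a" and "\<beta> = \<kappa> * b" and "\<gamma> = \<kappa> * c"
  have tri': "0 \<le> \<alpha>" "0 \<le> \<beta>" "0 < \<gamma>" "\<alpha> \<le> \<beta> + \<gamma>" "\<beta> \<le> \<alpha> + \<gamma>" "\<gamma> \<le> \<alpha> + \<beta>"
    using tri \<kappa> by (auto simp: \<alpha>_def \<beta>_def \<gamma>_def simp flip: distrib_left)
  have small': "\<alpha> \<le> \<rho>" "\<beta> \<le> \<rho>" "\<gamma> \<le> \<rho>"
    using small by (auto simp: \<alpha>_def \<beta>_def \<gamma>_def \<kappa>_def)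
  have pi: "2 < pi" using pi_gt3 by simp
  obtain u v where uv: "u\<^sup>2 + v\<^sup>2 + (cos \<alpha>)\<^sup>2 = 1" "cos \<alpha> * cos \<gamma> + u * sin \<gamma> = cos \<beta>"
    using sphere_coordinates[OF tri'] small' \<rho> pi by (metis add_mono_thms_linordered_semiring(1) dual_order.trans less_imp_le one_add_one)
  define y' :: point3 where "y' = (u, v, cos \<alpha>)"
  define q' :: "real \<Rightarrow> point3" where "q' s = (sin (\<kappa> * s), 0, cos (\<kappa> * s))" for s
  have md: "model_dist k p q = arccos (p \<bullet> q) / \<kappa>" for p q
    using k by (simp add: model_dist_def \<kappa>_def)
  have sym: "model_dist k p q = model_dist k q p" for p q
    by (simp add: md inner_commute)
  \<comment> \<open>\<open>w s\<close> is the cosine of the angular distance from \<open>y'\<close>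
    to the point at angle s along the side.\<close>
  define w where "w s = cos \<alpha> * cos s + u * sin s" for s
  have yq: "y' \<bullet> q' s = w (\<kappa> * s)" for s
    by (simp add: y'_def q'_def w_def)
  have ny: "norm y' = 1" and nq: "norm (q' s) = 1" for s
    using uv by (auto simp: y'_def q'_def norm_point3 add.assoc)
  have w1: "\<bar>w (\<kappa> * s)\<bar> \<le> 1" for s
    using Cauchy_Schwarz_ineq2[of y' "q' s"] by (simp add: yq ny nq)
  have qq: "model_dist k (q' s) (q' t) = t - s" if "0 \<le> s" "s \<le> t" "t \<le> c" for s t
  proof -
    have "\<kappa> * (t - s) \<le> \<gamma>" using that \<kappa> by (simp add: \<gamma>_def)
    then have "\<kappa> * (t - s) \<le> pi" using small' \<rho> pi by linarith
    moreover have "q' s \<bullet> q' t = cos (\<kappa> * (t - s))"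
      by (simp add: q'_def cos_diff right_diff_distrib mult.commute)
    ultimately show ?thesis using that \<kappa> by (simp add: md arccos_cos)
  qed
  show ?thesis
    unfolding almost_flat_comparison_def
  proof (rule exI[of _ "q' 0"], rule exI[of _ y'], rule exI[of _ "q' c"], rule exI[of _ q'],
      intro conjI ballI impI)
    show "model_dist k (q' 0) y' = a"
      using tri' small' \<rho> pi \<kappa>
      by (subst sym) (simp add: md yq w_def arccos_cos, simp add: \<alpha>_def)
    show "model_dist k y' (q' c) = b"
      using tri' small' \<rho> pi \<kappa> uv
      by (simp add: md yq w_def arccos_cos flip: \<gamma>_def) (simp add: \<beta>_def)
    show "model_dist k y' y' = 0"
      by (simp add: md ny dot_square_norm)
    show "(model_dist k y' (q' (c / 2)))\<^sup>2 \<le> (1 + \<epsilon>) * (a\<^sup>2 + b\<^sup>2) / 2 - c\<^sup>2 / 4"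
    proof -
      define \<mu> where "\<mu> = arccos (w (\<gamma> / 2))"
      have "\<bar>w (\<gamma> / 2)\<bar> \<le> 1" using w1[of "c/2"] by (simp add: \<gamma>_def)
      then have \<mu>: "0 \<le> \<mu>" "\<mu> \<le> pi" "cos \<mu> = w (\<gamma> / 2)"
        by (auto simp: \<mu>_def abs_le_iff intro!: arccos_lbound arccos_ubound)
      have c2: "1 - \<delta> \<le> cos (\<gamma>/2)" using near[of "\<gamma>/2"] tri' small' by auto
      \<comment> \<open>Two unit vectors at angle \<gamma> add up to 2 cos (\<gamma>/2) times their
        midpoint on the sphere; take the inner product with \<open>y'\<close>.\<close>
      have double: "2 * (cos (\<gamma>/2) * cos \<mu>) = cos \<alpha> + cos \<beta>"
      proof -
        have "2 * (cos (\<gamma>/2) * cos \<mu>) = cos \<alpha> * (2 * (cos (\<gamma>/2))\<^sup>2) + u * (2 * sin (\<gamma>/2) * cos (\<gamma>/2))"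
          unfolding \<mu> w_def by (simp add: algebra_simps power2_eq_square)
        also have "\<dots> = cos \<alpha> * (cos \<gamma> + 1) + u * sin \<gamma>"
          using cos_double_cos[of "\<gamma>/2"] sin_double[of "\<gamma>/2"] by simp
        finally show ?thesis using uv by (simp add: algebra_simps)
      qed
      \<comment> \<open>\<open>quad\<close> can be applied to the median only after \<mu> \<le>
        \<rho> is known. By \<open>double\<close>, cos (\<gamma>/2) * cos \<mu> is an average of two
        numbers that are at least cos \<rho>, and dropping the factor cos (\<gamma>/2) \<le> 1 does
        not decrease it.\<close>
      have "cos \<rho> \<le> cos \<mu>"
      proof -
        have 0: "0 < cos (\<gamma>/2)" using c2 \<delta> by simp
        have "cos \<rho> \<le> cos \<alpha>" "cos \<rho> \<le> cos \<beta>"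
          using tri' small' \<rho> pi by (auto intro!: cos_monotone_0_pi_le)
        then have le: "cos \<rho> \<le> cos (\<gamma>/2) * cos \<mu>" using double by linarith
        have "0 < cos \<rho>" using near[of \<rho>] \<rho> \<delta> by simp
        then have "0 \<le> cos \<mu>" using le 0 by (metis less_le_trans zero_less_mult_pos less_imp_le)
        then have "cos (\<gamma>/2) * cos \<mu> \<le> 1 * cos \<mu>" by (intro mult_right_mono) auto
        then show ?thesis using le by linarith
      qed
      then have \<mu>\<rho>: "\<mu> \<le> \<rho>" using \<mu> \<rho> pi by (subst (asm) cos_mono_le_eq) auto
      have "(1 - \<delta>)\<^sup>2 * \<mu>\<^sup>2 \<le> 2 * (cos (\<gamma>/2) * (1 - cos \<mu>))"
      proof -
        have "(1 - \<delta>) * ((1 - \<delta>) * \<mu>\<^sup>2 / 2) \<le> cos (\<gamma>/2) * (1 - cos \<mu>)"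
          using quad[of \<mu>] \<mu> \<mu>\<rho> c2 \<delta> by (intro mult_mono) auto
        then show ?thesis by (simp add: power2_eq_square)
      qed
      also have "\<dots> = (1 - cos \<alpha>) + (1 - cos \<beta>) - 2 * (1 - cos (\<gamma>/2))"
        using double by (simp add: algebra_simps)
      also have "\<dots> \<le> \<alpha>\<^sup>2/2 + \<beta>\<^sup>2/2 - (1 - \<delta>) * \<gamma>\<^sup>2/4"
        using one_minus_cos_le[of \<alpha>] one_minus_cos_le[of \<beta>] quad[of "\<gamma>/2"] tri' small'
        by (simp add: power_divide)
      \<comment> \<open>The last term is weakened so that the square of 1 - \<delta> becomes a
        common factor that cancels.\<close>
      also have "\<dots> \<le> \<alpha>\<^sup>2/2 + \<beta>\<^sup>2/2 - (1 - \<delta>)\<^sup>2 * \<gamma>\<^sup>2/4"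
        using \<delta> by (simp add: power2_eq_square mult_le_cancel_right1 mult.assoc mult_left_le_one_le)
      also have "\<dots> \<le> ((1 - \<delta>)\<^sup>2 * (1 + \<epsilon>)) * (\<alpha>\<^sup>2/2 + \<beta>\<^sup>2/2) - (1 - \<delta>)\<^sup>2 * \<gamma>\<^sup>2/4"
        using \<delta> mult_right_mono[OF \<delta>(3), of "\<alpha>\<^sup>2/2 + \<beta>\<^sup>2/2"] by simp
      also have "\<dots> = (1 - \<delta>)\<^sup>2 * ((1 + \<epsilon>) * (\<alpha>\<^sup>2/2 + \<beta>\<^sup>2/2) - \<gamma>\<^sup>2/4)"
        by (simp add: right_diff_distrib mult.assoc)
      finally have "\<mu>\<^sup>2 \<le> (1 + \<epsilon>) * (\<alpha>\<^sup>2/2 + \<beta>\<^sup>2/2) - \<gamma>\<^sup>2/4"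
        using \<delta> by (simp add: mult_le_cancel_left_pos)
      also have "\<dots> = \<kappa>\<^sup>2 * ((1 + \<epsilon>) * (a\<^sup>2 + b\<^sup>2) / 2 - c\<^sup>2 / 4)"
        by (simp add: \<alpha>_def \<beta>_def \<gamma>_def power_mult_distrib field_simps)
      finally show ?thesis
        using \<kappa> by (simp add: md yq power_divide \<mu>_def \<gamma>_def divide_le_eq mult.commute)
    qed
    assume *: "\<forall>s\<in>{0..c}. a \<le> model_dist k y' (q' s)"
    have "u \<le> 0"
    proof (rule derivative_nonpos_at_right_max)
      show "(w has_real_derivative u) (at 0)"
        unfolding w_def[abs_def] by (auto intro!: derivative_eq_intros)
      fix s assume s: "0 \<le> s" "s \<le> \<gamma>"
      have ws: "\<bar>w s\<bar> \<le> 1" using w1[of "s / \<kappa>"] \<kappa> by simp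
      have "a \<le> model_dist k y' (q' (s / \<kappa>))"
        using * s \<kappa> by (auto simp: \<gamma>_def divide_le_eq mult.commute)
      then have "\<alpha> \<le> arccos (w s)"
        using \<kappa> by (simp add: md yq \<alpha>_def le_divide_eq mult.commute)
      then have "cos (arccos (w s)) \<le> cos \<alpha>"
        using tri' ws by (intro cos_monotone_0_pi_le) (auto simp: abs_le_iff intro!: arccos_ubound)
      then show "w s \<le> w 0" using ws by (simp add: abs_le_iff) (simp add: w_def)
    qed (use tri' in auto)
    moreover have "0 \<le> sin \<gamma>" using tri' small' \<rho> pi by (intro sin_ge_zero) auto
    ultimately have "cos \<beta> \<le> cos \<alpha> * cos \<gamma>"
      using uv(2) by (smt (verit) mult_nonpos_nonneg)
    \<comment> \<open>The left side is 1 - cos \<alpha> * cos \<gamma>, split so that each summand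
      has its own quadratic lower bound.\<close>
    then have "(1 - cos \<alpha>) + cos \<alpha> * (1 - cos \<gamma>) \<le> \<beta>\<^sup>2/2"
      using one_minus_cos_le[of \<beta>] by (simp add: algebra_simps)
    moreover have "(1 - \<delta>) * ((1 - \<delta>) * \<gamma>\<^sup>2/2) \<le> cos \<alpha> * (1 - cos \<gamma>)"
      using near[of \<alpha>] quad[of \<gamma>] tri' small' \<delta> by (intro mult_mono) auto
    moreover have "(1 - \<delta>) * ((1 - \<delta>) * \<alpha>\<^sup>2/2) \<le> 1 - cos \<alpha>"
    proof -
      have "(1 - \<delta>) * ((1 - \<delta>) * \<alpha>\<^sup>2/2) \<le> 1 * ((1 - \<delta>) * \<alpha>\<^sup>2/2)"
        using \<delta> by (intro mult_right_mono) auto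
      then show ?thesis using quad[of \<alpha>] tri' small' by simp
    qed
    ultimately have "(1 - \<delta>)\<^sup>2 * (\<alpha>\<^sup>2 + \<gamma>\<^sup>2) \<le> \<beta>\<^sup>2"
      by (simp add: power2_eq_square distrib_left)
    also have "\<dots> \<le> ((1 - \<delta>)\<^sup>2 * (1 + \<epsilon>)) * \<beta>\<^sup>2"
      using mult_right_mono[OF \<delta>(3), of "\<beta>\<^sup>2"] by simp
    finally have "\<alpha>\<^sup>2 + \<gamma>\<^sup>2 \<le> (1 + \<epsilon>) * \<beta>\<^sup>2"
      using \<delta> by (simp add: mult.assoc mult_le_cancel_left_pos)
    then have "\<kappa>\<^sup>2 * (a\<^sup>2 + c\<^sup>2) \<le> \<kappa>\<^sup>2 * ((1 + \<epsilon>) * b\<^sup>2)"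
      by (simp add: \<alpha>_def \<beta>_def \<gamma>_def power_mult_distrib algebra_simps)
    then show "a\<^sup>2 + c\<^sup>2 \<le> (1 + \<epsilon>) * b\<^sup>2"
      using \<kappa> by (simp add: mult_le_cancel_left_pos)
  qed (use k tri ny nq sym[of "q' c" "q' 0"] in \<open>auto simp: model_plane_def qq\<close>)
qed

text \<open>The lower bound for cosh t - 1 by half the square of t holds for every t and costs no
  factor. Only upper bounds for cosh lose 1 + \<epsilon>, and they are applied just to the sides a
  and b, hence the smallness of these two.\<close>

lemma almost_flat_comparison_hyperbolic:
  fixes k \<epsilon> \<rho> a b c :: real
  assumes k: "k < 0" and \<epsilon>: "0 \<le> \<epsilon>"
    and quad: "\<And>t. 0 \<le> t \<Longrightarrow> t \<le> \<rho> \<Longrightarrow> cosh t - 1 \<le> (1 + \<epsilon>) * t\<^sup>2 / 2"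
    and tri: "0 \<le> a" "0 \<le> b" "0 < c" "a \<le> b + c" "b \<le> a + c" "c \<le> a + b"
    and small: "sqrt (- k) * a \<le> \<rho>" "sqrt (- k) * b \<le> \<rho>"
  shows "almost_flat_comparison k \<epsilon> a b c"
proof -
  define \<kappa> where "\<kappa> = sqrt (- k)"
  have \<kappa>: "0 < \<kappa>" using k by (auto simp: \<kappa>_def)
  define \<alpha> \<beta> \<gamma> where "\<alpha> = \<kappa> * a" and "\<beta> = \<kappa> * b" and "\<gamma> = \<kappa> * c"
  have tri': "0 \<le> \<alpha>" "0 \<le> \<beta>" "0 < \<gamma>" "\<alpha> \<le> \<beta> + \<gamma>" "\<beta> \<le> \<alpha> + \<gamma>" "\<gamma> \<le> \<alpha> + \<beta>"
    using tri \<kappa> by (auto simp: \<alpha>_def \<beta>_def \<gamma>_def simp flip: distrib_left)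
  have small': "\<alpha> \<le> \<rho>" "\<beta> \<le> \<rho>"
    using small by (auto simp: \<alpha>_def \<beta>_def \<kappa>_def)
  obtain u v where uv: "u\<^sup>2 + v\<^sup>2 + 1 = (cosh \<alpha>)\<^sup>2" "cosh \<alpha> * cosh \<gamma> - u * sinh \<gamma> = cosh \<beta>"
    using hyperboloid_coordinates[OF tri'] by metis
  define y' :: point3 where "y' = (u, v, cosh \<alpha>)"
  define q' :: "real \<Rightarrow> point3" where "q' s = (sinh (\<kappa> * s), 0, cosh (\<kappa> * s))" for s
  have plane: "y' \<in> model_plane k" "q' s \<in> model_plane k" for s
    using k uv
    by (auto simp: model_plane_def y'_def q'_def minkowski_def cosh_square_eq simp flip: power2_eq_square)
  have md: "model_dist k p q = arcosh (- minkowski p q) / \<kappa>" for p q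
    using k by (simp add: model_dist_def \<kappa>_def)
  have sym: "model_dist k p q = model_dist k q p" for p q
    by (simp add: md minkowski_def case_prod_unfold mult.commute)
  define w where "w s = cosh \<alpha> * cosh s - u * sinh s" for s
  have yq: "- minkowski y' (q' s) = w (\<kappa> * s)" for s
    by (simp add: y'_def q'_def w_def minkowski_def)
  \<comment> \<open>cosh inverts arcosh only on arguments that are at least 1. This is the reversed
    Cauchy-Schwarz inequality: \<bar>u\<bar> \<le> sinh \<alpha> gives \<open>w s\<close> \<ge> cosh
    (\<alpha> - \<bar>s\<bar>).\<close>
  have w1: "1 \<le> w s" for s
  proof -
    have "\<bar>u\<bar> \<le> sqrt (u\<^sup>2 + v\<^sup>2)" by (rule real_le_rsqrt) simp
    also have "\<dots> = sinh \<alpha>"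
    proof -
      have "u\<^sup>2 + v\<^sup>2 = (sinh \<alpha>)\<^sup>2" using uv by (simp add: cosh_square_eq)
      then show ?thesis using tri' by simp
    qed
    finally have "\<bar>u * sinh s\<bar> \<le> sinh \<alpha> * sinh \<bar>s\<bar>"
      by (simp add: abs_mult mult_right_mono)
    moreover have "1 \<le> cosh (\<alpha> - \<bar>s\<bar>)" by (rule cosh_real_ge_1)
    ultimately show ?thesis by (simp add: w_def cosh_diff abs_le_iff)
  qed
  have qq: "model_dist k (q' s) (q' t) = t - s" if "s \<le> t" for s t
  proof -
    have "- minkowski (q' s) (q' t) = cosh (\<kappa> * (t - s))"
      by (simp add: q'_def minkowski_def cosh_diff right_diff_distrib mult.commute)
    then show ?thesis using that \<kappa> by (simp add: md arcosh_cosh_real)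
  qed
  show ?thesis
    unfolding almost_flat_comparison_def
  proof (rule exI[of _ "q' 0"], rule exI[of _ y'], rule exI[of _ "q' c"], rule exI[of _ q'],
      intro conjI ballI impI)
    show "model_dist k (q' 0) y' = a"
      using tri' \<kappa> by (subst sym) (simp add: md yq w_def arcosh_cosh_real, simp add: \<alpha>_def)
    show "model_dist k y' (q' c) = b"
      using tri' \<kappa> uv by (simp add: md yq w_def arcosh_cosh_real flip: \<gamma>_def) (simp add: \<beta>_def)
    show "model_dist k y' y' = 0"
    proof -
      have "- minkowski y' y' = 1"
        using uv by (simp add: y'_def minkowski_def power2_eq_square)
      then show ?thesis by (simp add: md)
    qed
    show "(model_dist k y' (q' (c / 2)))\<^sup>2 \<le> (1 + \<epsilon>) * (a\<^sup>2 + b\<^sup>2) / 2 - c\<^sup>2 / 4"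
    proof -
      define \<mu> where "\<mu> = arcosh (w (\<gamma> / 2))"
      have \<mu>: "cosh \<mu> = w (\<gamma> / 2)" using w1 by (simp add: \<mu>_def)
      have double: "2 * (cosh (\<gamma>/2) * cosh \<mu>) = cosh \<alpha> + cosh \<beta>"
      proof -
        have "2 * (cosh (\<gamma>/2) * cosh \<mu>) = cosh \<alpha> * (2 * (cosh (\<gamma>/2))\<^sup>2) - u * (2 * sinh (\<gamma>/2) * cosh (\<gamma>/2))"
          unfolding \<mu> w_def by (simp add: algebra_simps power2_eq_square)
        also have "\<dots> = cosh \<alpha> * (cosh \<gamma> + 1) - u * sinh \<gamma>"
          using cosh_double_cosh[of "\<gamma>/2"] sinh_double[of "\<gamma>/2"] by simp
        finally show ?thesis using uv by (simp add: algebra_simps)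
      qed
      have "\<mu>\<^sup>2 \<le> 2 * (cosh (\<gamma>/2) * (cosh \<mu> - 1))"
      proof -
        have "1 * (\<mu>\<^sup>2 / 2) \<le> cosh (\<gamma>/2) * (cosh \<mu> - 1)"
          using cosh_minus_one_ge[of \<mu>] by (intro mult_mono cosh_real_ge_1) auto
        then show ?thesis by simp
      qed
      also have "\<dots> = (cosh \<alpha> - 1) + (cosh \<beta> - 1) - 2 * (cosh (\<gamma>/2) - 1)"
        using double by (simp add: algebra_simps)
      also have "\<dots> \<le> (1 + \<epsilon>) * \<alpha>\<^sup>2/2 + (1 + \<epsilon>) * \<beta>\<^sup>2/2 - \<gamma>\<^sup>2/4"
        using quad[of \<alpha>] quad[of \<beta>] cosh_minus_one_ge[of "\<gamma>/2"] tri' small'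
        by (simp add: power_divide)
      also have "\<dots> = \<kappa>\<^sup>2 * ((1 + \<epsilon>) * (a\<^sup>2 + b\<^sup>2) / 2 - c\<^sup>2 / 4)"
        by (simp add: \<alpha>_def \<beta>_def \<gamma>_def power_mult_distrib algebra_simps add_divide_distrib)
      finally show ?thesis
        using \<kappa> by (simp add: md yq power_divide \<mu>_def \<gamma>_def divide_le_eq mult.commute)
    qed
    assume *: "\<forall>s\<in>{0..c}. a \<le> model_dist k y' (q' s)"
    have "u \<le> 0"
    proof (rule derivative_nonpos_at_right_max)
      show "((\<lambda>s. - w s) has_real_derivative u) (at 0)"
        unfolding w_def[abs_def] by (auto intro!: derivative_eq_intros)
      fix s assume s: "0 \<le> s" "s \<le> \<gamma>"
      have "a \<le> model_dist k y' (q' (s / \<kappa>))"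
        using * s \<kappa> by (auto simp: \<gamma>_def divide_le_eq mult.commute)
      then have "\<alpha> \<le> arcosh (w s)"
        using \<kappa> by (simp add: md yq \<alpha>_def le_divide_eq mult.commute)
      then have "cosh \<alpha> \<le> cosh (arcosh (w s))"
        using tri' w1[of s] by (subst cosh_real_nonneg_le_iff) auto
      then show "- w s \<le> - w 0" using w1[of s] by simp (simp add: w_def)
    qed (use tri' in auto)
    then have "cosh \<alpha> * cosh \<gamma> \<le> cosh \<beta>"
      using uv(2) tri' by (smt (verit) mult_nonpos_nonneg sinh_real_nonneg_iff)
    \<comment> \<open>Expanding bounds the product cosh \<alpha> * cosh \<gamma> below by cosh
      \<alpha> + cosh \<gamma> - 1, which separates the two sides.\<close>
    moreover have "0 \<le> (cosh \<alpha> - 1) * (cosh \<gamma> - 1)"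
      using cosh_real_ge_1 by (intro mult_nonneg_nonneg) (simp_all add: cosh_real_ge_1)
    ultimately have "(cosh \<alpha> - 1) + (cosh \<gamma> - 1) \<le> (1 + \<epsilon>) * \<beta>\<^sup>2 / 2"
      using quad[of \<beta>] tri' small' by (simp add: algebra_simps)
    then have "\<alpha>\<^sup>2 + \<gamma>\<^sup>2 \<le> (1 + \<epsilon>) * \<beta>\<^sup>2"
      using cosh_minus_one_ge[of \<alpha>] cosh_minus_one_ge[of \<gamma>] by linarith
    then have "\<kappa>\<^sup>2 * (a\<^sup>2 + c\<^sup>2) \<le> \<kappa>\<^sup>2 * ((1 + \<epsilon>) * b\<^sup>2)"
      by (simp add: \<alpha>_def \<beta>_def \<gamma>_def power_mult_distrib algebra_simps)
    then show "a\<^sup>2 + c\<^sup>2 \<le> (1 + \<epsilon>) * b\<^sup>2"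
      using \<kappa> by (simp add: mult_le_cancel_left_pos)
  qed (use tri plane sym[of "q' c" "q' 0"] in \<open>auto simp: qq\<close>)
qed

text \<open>Rescaling by the square root of \<bar>k\<bar> reduces to the unit sphere and the unit
  hyperboloid, where the Taylor bounds hold below one radius for all shapes of triangles.\<close>

lemma small_triangles_almost_flat:
  fixes k \<epsilon> :: real
  assumes "0 < \<epsilon>"
  obtains \<rho> where "0 < \<rho>"
    "\<And>a b c. \<lbrakk>0 \<le> a; 0 \<le> b; 0 < c; a \<le> \<rho>; b \<le> \<rho>; c \<le> \<rho>; a \<le> b + c; b \<le> a + c; c \<le> a + b\<rbrakk>
       \<Longrightarrow> almost_flat_comparison k \<epsilon> a b c"
proof -
  \<comment> \<open>Solves (1 - 2 * \<delta>) * (1 + \<epsilon>) = 1, and the square of 1 - \<delta>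
    is at least 1 - 2 * \<delta>.\<close>
  define \<delta> where "\<delta> = \<epsilon> / (2 * (1 + \<epsilon>))"
  have \<delta>: "0 < \<delta>" "\<delta> < 1" "\<delta> \<le> \<epsilon>"
    using assms by (auto simp: \<delta>_def field_simps)
  have "1 = (1 - 2 * \<delta>) * (1 + \<epsilon>)"
    using assms by (simp add: \<delta>_def field_simps)
  also have "\<dots> \<le> (1 - \<delta>)\<^sup>2 * (1 + \<epsilon>)"
    using assms by (intro mult_right_mono) (auto simp: power2_diff)
  finally have \<delta>\<epsilon>: "1 \<le> (1 - \<delta>)\<^sup>2 * (1 + \<epsilon>)" .
  obtain \<rho> where \<rho>: "0 < \<rho>" "\<rho> \<le> 1"
    "\<And>t. 0 \<le> t \<Longrightarrow> t \<le> \<rho> \<Longrightarrow> (1 - \<delta>) * t\<^sup>2 / 2 \<le> 1 - cos t"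
    "\<And>t. 0 \<le> t \<Longrightarrow> t \<le> \<rho> \<Longrightarrow> cosh t - 1 \<le> (1 + \<delta>) * t\<^sup>2 / 2"
    "\<And>t. 0 \<le> t \<Longrightarrow> t \<le> \<rho> \<Longrightarrow> 1 - \<delta> \<le> cos t"
    using cos_cosh_quadratic[OF \<delta>(1)] by metis
  have cosh: "cosh t - 1 \<le> (1 + \<epsilon>) * t\<^sup>2 / 2" if "0 \<le> t" "t \<le> \<rho>" for t
  proof -
    have "(1 + \<delta>) * t\<^sup>2 \<le> (1 + \<epsilon>) * t\<^sup>2" using \<delta> by (intro mult_right_mono) auto
    with \<rho>(4)[OF that] show ?thesis by linarith
  qed
  consider "k = 0" | "0 < k" | "k < 0" by linarith
  then show thesis
  proof cases
    case 1
    show thesis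
      by (rule that[of 1]) (use assms in \<open>auto simp: 1 intro: almost_flat_comparison_euclidean\<close>)
  next
    case 2
    show thesis
    proof (rule that[of "\<rho> / sqrt k"])
      fix a b c :: real
      assume tri: "0 \<le> a" "0 \<le> b" "0 < c" and small: "a \<le> \<rho> / sqrt k" "b \<le> \<rho> / sqrt k" "c \<le> \<rho> / sqrt k"
        and tri': "a \<le> b + c" "b \<le> a + c" "c \<le> a + b"
      show "almost_flat_comparison k \<epsilon> a b c"
        using almost_flat_comparison_spherical[OF 2 \<delta>(1,2) \<delta>\<epsilon> less_imp_le[OF assms] \<rho>(1,2,3,5) tri tri']
          small 2 by (simp add: pos_le_divide_eq mult.commute)
    qed (use \<rho> 2 in auto)
  next
    case 3
    then have 0: "0 < sqrt (- k)" by simp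
    show thesis
    proof (rule that[of "\<rho> / sqrt (- k)"])
      fix a b c :: real
      assume tri: "0 \<le> a" "0 \<le> b" "0 < c" and small: "a \<le> \<rho> / sqrt (- k)" "b \<le> \<rho> / sqrt (- k)"
        and tri': "a \<le> b + c" "b \<le> a + c" "c \<le> a + b"
      show "almost_flat_comparison k \<epsilon> a b c"
        using almost_flat_comparison_hyperbolic[OF 3 less_imp_le[OF assms] cosh tri tri']
          small by (simp add: pos_le_divide_eq[OF 0] mult.commute del: real_sqrt_minus real_sqrt_gt_0_iff)
    qed (use \<rho> 0 in \<open>auto simp del: real_sqrt_minus\<close>)
  qed
qed

section \<open>Small rectangles spanned by fibres\<close>

lemma geodesic_segmentE:
  assumes "geodesic_segment M d x y S"
  obtains \<gamma> where "0 \<le> d x y" "S = \<gamma> ` {0..d x y}" "\<gamma> ` {0..d x y} \<subseteq> M" "\<gamma> 0 = x" "\<gamma> (d x y) = y"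
    "\<forall>s\<in>{0..d x y}. \<forall>t\<in>{0..d x y}. d (\<gamma> s) (\<gamma> t) = \<bar>s - t\<bar>"
proof -
  obtain l \<gamma> where *: "0 \<le> l" "S = \<gamma> ` {0..l}" "S \<subseteq> M" "\<gamma> 0 = x" "\<gamma> l = y"
    "\<forall>s\<in>{0..l}. \<forall>t\<in>{0..l}. d (\<gamma> s) (\<gamma> t) = \<bar>s - t\<bar>"
    using assms unfolding geodesic_segment_def by blast
  then have "d x y = l" by fastforce
  with * show thesis by (intro that[of \<gamma>]) auto
qed

text \<open>Thinness is used with the vertex y as the point on the side from x to y, so every
  distance from y to the side from x to z is at most the comparison distance. This direction serves
  both claims: it carries the median bound from the model to the space, and the hypothesis on the
  corner from the space to the model.\<close>

lemma thin_triangle_estimates: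
  assumes "Metric_space U d" and thin: "triangles_thin k U d U"
    and xyz: "x \<in> U" "y \<in> U" "z \<in> U" and per: "small_perimeter k d x y z"
    and segs: "geodesic_segment U d x y S" "geodesic_segment U d y z T"
    and \<gamma>: "\<gamma> ` {0..d x z} \<subseteq> U" "\<gamma> 0 = x" "\<gamma> (d x z) = z"
      "\<forall>s\<in>{0..d x z}. \<forall>t\<in>{0..d x z}. d (\<gamma> s) (\<gamma> t) = \<bar>s - t\<bar>"
    and flat: "almost_flat_comparison k \<epsilon> (d x y) (d y z) (d x z)"
  shows "(d y (\<gamma> (d x z / 2)))\<^sup>2 \<le> (1 + \<epsilon>) * ((d x y)\<^sup>2 + (d y z)\<^sup>2) / 2 - (d x z)\<^sup>2 / 4"
    and "\<forall>s\<in>{0..d x z}. d x y \<le> d y (\<gamma> s) \<Longrightarrow> (d x y)\<^sup>2 + (d x z)\<^sup>2 \<le> (1 + \<epsilon>) * (d y z)\<^sup>2"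
proof -
  interpret Metric_space U d by fact
  obtain x' y' z' q' where cmp: "{x', y', z'} \<subseteq> model_plane k" "q' ` {0..d x z} \<subseteq> model_plane k"
    "model_dist k x' y' = d x y" "model_dist k y' z' = d y z" "model_dist k z' x' = d x z"
    "model_dist k y' y' = 0"
    "\<And>s. s\<in>{0..d x z} \<Longrightarrow> model_dist k x' (q' s) = s \<and> model_dist k (q' s) z' = d x z - s"
    and est: "(model_dist k y' (q' (d x z / 2)))\<^sup>2 \<le> (1 + \<epsilon>) * ((d x y)\<^sup>2 + (d y z)\<^sup>2) / 2 - (d x z)\<^sup>2 / 4"
    "\<forall>s\<in>{0..d x z}. d x y \<le> model_dist k y' (q' s) \<Longrightarrow> (d x y)\<^sup>2 + (d x z)\<^sup>2 \<le> (1 + \<epsilon>) * (d y z)\<^sup>2"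
    using flat unfolding almost_flat_comparison_def by blast
  have seg: "geodesic_segment U d x z (\<gamma> ` {0..d x z})"
    unfolding geodesic_segment_def using \<gamma> by (intro exI[of _ "d x z"] exI[of _ \<gamma>]) auto
  have y: "y \<in> S" using segs(1) by (rule geodesic_segmentE) (metis atLeastAtMost_iff image_eqI order_refl)
  have le: "d y (\<gamma> s) \<le> model_dist k y' (q' s)" if s: "s \<in> {0..d x z}" for s
  proof -
    have "comparison_points k d x y z y (\<gamma> s) x' y' z' y' (q' s)"
      unfolding comparison_points_def
      using cmp s xyz bspec[OF bspec[OF \<gamma>(4), of 0], of s] bspec[OF bspec[OF \<gamma>(4), of s], of "d x z"] \<gamma>(2,3)
      by (auto simp: commute[of z x])
    then show ?thesis
      using thin xyz per segs seg y s unfolding triangles_thin_def by blast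
  qed
  have "(d y (\<gamma> (d x z / 2)))\<^sup>2 \<le> (model_dist k y' (q' (d x z / 2)))\<^sup>2"
    using le[of "d x z / 2"] by (intro power_mono) auto
  with est(1) show "(d y (\<gamma> (d x z / 2)))\<^sup>2 \<le> (1 + \<epsilon>) * ((d x y)\<^sup>2 + (d y z)\<^sup>2) / 2 - (d x z)\<^sup>2 / 4"
    by linarith
  show "(d x y)\<^sup>2 + (d x z)\<^sup>2 \<le> (1 + \<epsilon>) * (d y z)\<^sup>2" if "\<forall>s\<in>{0..d x z}. d x y \<le> d y (\<gamma> s)"
  proof (rule est(2), rule ballI)
    fix s assume "s \<in> {0..d x z}"
    then show "d x y \<le> model_dist k y' (q' s)"
      using that le[of s] by fastforce
  qed
qed

text \<open>Together, \<open>fst_short\<close> and \<open>fst_fibre\<close> say that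
  \<open>(x', y)\<close> is a closest point to \<open>(x, y)\<close> in the fibre over
  \<open>x'\<close>; likewise for the other factor. This is the orthogonality of the fibres.\<close>

locale orthogonal_fibres = Metric_space "X \<times> Y" d
  for X :: "'a set" and Y :: "'b set" and d :: "'a \<times> 'b \<Rightarrow> 'a \<times> 'b \<Rightarrow> real" +
  fixes dX :: "'a \<Rightarrow> 'a \<Rightarrow> real" and dY :: "'b \<Rightarrow> 'b \<Rightarrow> real"
  assumes fst_short: "\<lbrakk>x \<in> X; y \<in> Y; x' \<in> X; y' \<in> Y\<rbrakk> \<Longrightarrow> dX x x' \<le> d (x, y) (x', y')"
    and snd_short: "\<lbrakk>x \<in> X; y \<in> Y; x' \<in> X; y' \<in> Y\<rbrakk> \<Longrightarrow> dY y y' \<le> d (x, y) (x', y')"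
    and fst_fibre: "\<lbrakk>x \<in> X; y \<in> Y; x' \<in> X\<rbrakk> \<Longrightarrow> d (x, y) (x', y) = dX x x'"
    and snd_fibre: "\<lbrakk>x \<in> X; y \<in> Y; y' \<in> Y\<rbrakk> \<Longrightarrow> d (x, y) (x, y') = dY y y'"
begin

text \<open>
  A geodesic joining two points of a fibre projects to a geodesic of \<open>Y\<close>, because the projection is
  short and preserves the distance of the end points; this is lifted back to the fibre.
\<close>

lemma fibre_geodesic:
  assumes U: "U \<subseteq> X \<times> Y" and seg: "geodesic_segment U d (x, y) (x, y') S" and xy: "x \<in> X" "y \<in> Y" "y' \<in> Y"
    and near: "\<And>v. v \<in> Y \<Longrightarrow> d (x, y) (x, v) \<le> d (x, y) (x, y') \<Longrightarrow> (x, v) \<in> U"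
  obtains \<gamma> where "\<gamma> ` {0..d (x, y) (x, y')} \<subseteq> U" "\<gamma> 0 = (x, y)" "\<gamma> (d (x, y) (x, y')) = (x, y')"
    "\<forall>s\<in>{0..d (x, y) (x, y')}. \<forall>t\<in>{0..d (x, y) (x, y')}. d (\<gamma> s) (\<gamma> t) = \<bar>s - t\<bar>"
    "\<And>s. s \<in> {0..d (x, y) (x, y')} \<Longrightarrow> fst (\<gamma> s) = x"
proof -
  define l where "l = d (x, y) (x, y')"
  obtain \<gamma> where \<gamma>: "0 \<le> l" "\<gamma> ` {0..l} \<subseteq> U" "\<gamma> 0 = (x, y)" "\<gamma> l = (x, y')"
    "\<forall>s\<in>{0..l}. \<forall>t\<in>{0..l}. d (\<gamma> s) (\<gamma> t) = \<bar>s - t\<bar>"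
    using seg unfolding l_def by (elim geodesic_segmentE) blast
  define \<eta> where "\<eta> s = (x, snd (\<gamma> s))" for s
  have in_Y: "snd (\<gamma> s) \<in> Y" "fst (\<gamma> s) \<in> X" if "s \<in> {0..l}" for s
  proof -
    have "\<gamma> s \<in> X \<times> Y" using \<gamma>(2) U that by blast
    then show "snd (\<gamma> s) \<in> Y" "fst (\<gamma> s) \<in> X" by (auto simp: mem_Times_iff)
  qed
  have in_M: "\<eta> s \<in> X \<times> Y" if "s \<in> {0..l}" for s
    using in_Y that xy by (auto simp: \<eta>_def)
  have short: "d (\<eta> s) (\<eta> t) \<le> \<bar>s - t\<bar>" if "s \<in> {0..l}" "t \<in> {0..l}" for s t
    using snd_short[of "fst (\<gamma> s)" "snd (\<gamma> s)" "fst (\<gamma> t)" "snd (\<gamma> t)"] bspec[OF bspec[OF \<gamma>(5) that(1)] that(2)] that in_Y xy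
    by (simp add: \<eta>_def snd_fibre)
  have ends: "\<eta> 0 = (x, y)" "\<eta> l = (x, y')" by (auto simp: \<eta>_def \<gamma>)
  have full: "d (\<eta> 0) (\<eta> l) = l" by (simp add: ends flip: l_def)
  \<comment> \<open>The three pieces between 0, s, t and l have lengths at most s, t - s and l - s
    for the respective gaps, while their total is at least the distance l of the ends, so no piece
    can be shorter than its parameter gap.\<close>
  have iso_le: "d (\<eta> s) (\<eta> t) = t - s" if st: "s \<in> {0..l}" "t \<in> {0..l}" "s \<le> t" for s t
  proof -
    have "l \<le> d (\<eta> 0) (\<eta> s) + d (\<eta> s) (\<eta> l)"
      using triangle[of "\<eta> 0" "\<eta> s" "\<eta> l"] in_M[of 0] in_M[of s] in_M[of l] st \<gamma>(1) full by simp
    also have "d (\<eta> s) (\<eta> l) \<le> d (\<eta> s) (\<eta> t) + d (\<eta> t) (\<eta> l)"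
      using triangle[of "\<eta> s" "\<eta> t" "\<eta> l"] in_M st \<gamma>(1) by simp
    finally show ?thesis
      using short[of 0 s] short[of t l] short[of s t] st \<gamma>(1) by auto
  qed
  have iso: "d (\<eta> s) (\<eta> t) = \<bar>s - t\<bar>" if st: "s \<in> {0..l}" "t \<in> {0..l}" for s t
    using iso_le[of s t] iso_le[of t s] st by (cases "s \<le> t") (auto simp: commute)
  show thesis
  proof (rule that[of \<eta>, folded l_def])
    show "\<eta> ` {0..l} \<subseteq> U"
    proof (rule image_subsetI)
      fix s assume s: "s \<in> {0..l}"
      then have "d (x, y) (\<eta> s) \<le> l" using iso[of 0 s] \<gamma>(1) ends by auto
      then show "\<eta> s \<in> U" using near[of "snd (\<gamma> s)"] in_Y[OF s] by (simp add: \<eta>_def l_def)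
    qed
  qed (use ends iso in \<open>auto simp: \<eta>_def\<close>)
qed

text \<open>
  In the rectangle with vertices \<open>(x, y)\<close>, \<open>(x', y)\<close>, \<open>(x', y')\<close>, \<open>(x, y')\<close> the angles are at least right,
  which bounds both diagonals from below. The medians from \<open>(x', y)\<close> and \<open>(x, y')\<close> to the diagonal
  from \<open>(x, y)\<close> to \<open>(x', y')\<close> bound the sum of the squares of the diagonals from above.
\<close>

lemma locally_almost_product:
  assumes cat: "CAT k (mball p\<^sub>0 r) d" and r: "0 < r" and p\<^sub>0: "p\<^sub>0 \<in> X \<times> Y" and \<epsilon>: "0 < \<epsilon>"
  obtains \<delta> where "0 < \<delta>" "\<And>p q. \<lbrakk>p \<in> mball p\<^sub>0 \<delta>; q \<in> mball p\<^sub>0 \<delta>\<rbrakk> \<Longrightarrow>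
     (d p q)\<^sup>2 \<le> (1 + \<epsilon>) * (prod_dist dX dY p q)\<^sup>2 \<and> (prod_dist dX dY p q)\<^sup>2 \<le> (1 + \<epsilon>) * (d p q)\<^sup>2"
proof -
  \<comment> \<open>The upper bound for a diagonal ends with the factor 1 + 3 * \<epsilon>'.\<close>
  define \<epsilon>' where "\<epsilon>' = \<epsilon> / 3"
  have \<epsilon>': "0 < \<epsilon>'" using \<epsilon> by (simp add: \<epsilon>'_def)
  obtain \<rho> where \<rho>: "0 < \<rho>"
    "\<And>a b c. \<lbrakk>0 \<le> a; 0 \<le> b; 0 < c; a \<le> \<rho>; b \<le> \<rho>; c \<le> \<rho>; a \<le> b + c; b \<le> a + c; c \<le> a + b\<rbrakk>
       \<Longrightarrow> almost_flat_comparison k \<epsilon>' a b c"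
    using small_triangles_almost_flat[OF \<epsilon>'] by metis
  \<comment> \<open>For k > 0 this is half the bound on the perimeter; otherwise there is no such
    bound and 1 is a placeholder.\<close>
  define R where "R = (if k > 0 then pi / sqrt k else 1)"
  have R: "0 < R" by (simp add: R_def)
  \<comment> \<open>The sides a and b come out below 2 * \<delta>. Points within 4 * \<delta> of p
    then stay within 5 * \<delta> of the centre, the diagonals are below 4 * \<delta>, and the
    perimeters are at most 2 * (a + b) < 8 * \<delta>.\<close>
  define \<delta> where "\<delta> = min (min (r / 5) (\<rho> / 4)) (R / 8)"
  have \<delta>: "0 < \<delta>" "5 * \<delta> \<le> r" "4 * \<delta> \<le> \<rho>" "8 * \<delta> \<le> R"
    using r \<rho>(1) R by (auto simp: \<delta>_def min_def)
  let ?U = "mball p\<^sub>0 r"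
  have thin: "triangles_thin k ?U d ?U" and U: "Metric_space ?U d"
    using cat by (auto simp: CAT_def)
  have seg: "\<exists>S. geodesic_segment ?U d u v S" if "u \<in> ?U" "v \<in> ?U" "d u v < 8 * \<delta>" for u v
  proof -
    have "small_distance k d u v" using that(3) \<delta>(4) by (auto simp: small_distance_def R_def)
    then show ?thesis using cat that(1,2) unfolding CAT_def by blast
  qed
  show thesis
  proof (rule that[OF \<delta>(1)])
    fix p q assume pq: "p \<in> mball p\<^sub>0 \<delta>" "q \<in> mball p\<^sub>0 \<delta>"
    obtain x y where p: "p = (x, y)" "x \<in> X" "y \<in> Y" using pq by (cases p) auto
    obtain x' y' where q: "q = (x', y')" "x' \<in> X" "y' \<in> Y" using pq by (cases q) auto
    define a b where "a = dX x x'" and "b = dY y y'"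
    have fib: "d (x, y) (x', y) = a" "d (x, y') (x', y') = a" "d (x, y) (x, y') = b" "d (x', y) (x', y') = b"
      using p q by (auto simp: a_def b_def fst_fibre snd_fibre)
    have ab0: "0 \<le> a" "0 \<le> b" using fib nonneg by metis+
    let ?D = "d (x, y) (x', y')"
    let ?E = "d (x', y) (x, y')"
    have D: "a \<le> ?D" "b \<le> ?D" using p q by (auto simp: a_def b_def fst_short snd_short)
    have E: "a \<le> ?E" "b \<le> ?E"
      using p q fst_short[of x y' x' y] snd_short[of x' y x y'] by (auto simp: a_def b_def commute)
    have D': "?D \<le> a + b"
      using triangle[of "(x, y)" "(x', y)" "(x', y')"] p q fib by simp
    have E': "?E \<le> a + b"
      using triangle[of "(x', y)" "(x, y)" "(x, y')"] p q fib by (simp add: commute[of "(x', y)"])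
    have "?D < 2 * \<delta>"
      using triangle[of p p\<^sub>0 q] pq by (simp add: p q commute[of "(x, y)" p\<^sub>0])
    then have ab: "a < 2 * \<delta>" "b < 2 * \<delta>" using D by auto
    have small: "a \<le> \<rho>" "b \<le> \<rho>" "?D \<le> \<rho>" "?E \<le> \<rho>" using ab D' E' \<delta>(1,3) by auto
    have near: "v \<in> ?U" if "v \<in> X \<times> Y" "d (x, y) v < 4 * \<delta>" for v
      using triangle[of p\<^sub>0 p v] that pq p p\<^sub>0 \<delta> by auto
    have corners: "(x, y) \<in> ?U" "(x', y) \<in> ?U" "(x, y') \<in> ?U" "(x', y') \<in> ?U"
      using near p q fib ab D' E' ab0 \<delta>(1) by auto
    have prod: "(prod_dist dX dY p q)\<^sup>2 = a\<^sup>2 + b\<^sup>2"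
      by (simp add: prod_dist_def p q a_def b_def)
    show "(d p q)\<^sup>2 \<le> (1 + \<epsilon>) * (prod_dist dX dY p q)\<^sup>2 \<and> (prod_dist dX dY p q)\<^sup>2 \<le> (1 + \<epsilon>) * (d p q)\<^sup>2"
    proof (cases "a = 0 \<or> b = 0")
      \<comment> \<open>A degenerate rectangle admits no comparison triangle with c > 0, but here
        the short projections and the triangle inequality already determine the diagonal
        exactly.\<close>
      case True
      then have "(prod_dist dX dY p q)\<^sup>2 = (d p q)\<^sup>2"
        using D D' unfolding prod by (auto simp: p q)
      then show ?thesis
        using \<epsilon> mult_right_mono[of 1 "1 + \<epsilon>" "(d p q)\<^sup>2"] by simp
    next
      case False
      then have pos: "0 < a" "0 < b" "0 < ?D" using ab0 D by auto
      obtain S1 S2 S3 S4 S5 S6 where segs: "geodesic_segment ?U d (x, y) (x', y) S1"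
        "geodesic_segment ?U d (x, y) (x, y') S2" "geodesic_segment ?U d (x', y) (x', y') S3"
        "geodesic_segment ?U d (x, y') (x', y') S4" "geodesic_segment ?U d (x, y) (x', y') S5"
        "geodesic_segment ?U d (x', y) (x, y') S6"
        using seg corners fib ab D' E' \<delta>(1) by (smt (verit, best))
      have segs': "\<exists>S. geodesic_segment ?U d (x', y) (x, y) S"
        using seg[of "(x', y)" "(x, y)"] corners fib ab \<delta>(1) by (simp add: commute)
      have per: "small_perimeter k d u v w" if "d u v + d v w + d w u \<le> 2 * (a + b)" for u v w
      proof -
        have "2 * (a + b) < R" using ab \<delta>(4) by simp
        then have "d u v + d v w + d w u < 2 * R" using that R by linarith
        then show ?thesis by (cases "k > 0") (simp_all add: small_perimeter_def R_def)
      qed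
      \<comment> \<open>The corner is \<open>(x', y)\<close>. Its side to \<open>(x', y')\<close>
        must be a geodesic within the fibre over \<open>x'\<close>: an arbitrary geodesic could
        leave the fibre, and then \<open>fst_short\<close> would not keep it at distance at least a
        from \<open>(x, y)\<close>.\<close>
      have lower_D: "a\<^sup>2 + b\<^sup>2 \<le> (1 + \<epsilon>') * ?D\<^sup>2"
      proof -
        obtain \<gamma> where \<gamma>: "\<gamma> ` {0..d (x', y) (x', y')} \<subseteq> ?U" "\<gamma> 0 = (x', y)" "\<gamma> (d (x', y) (x', y')) = (x', y')"
          "\<forall>s\<in>{0..d (x', y) (x', y')}. \<forall>t\<in>{0..d (x', y) (x', y')}. d (\<gamma> s) (\<gamma> t) = \<bar>s - t\<bar>"
          "\<And>s. s \<in> {0..d (x', y) (x', y')} \<Longrightarrow> fst (\<gamma> s) = x'"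
        proof (rule fibre_geodesic[OF mball_subset_mspace segs(3)])
          fix v assume v: "v \<in> Y" "d (x', y) (x', v) \<le> d (x', y) (x', y')"
          then show "(x', v) \<in> ?U"
            using triangle[of "(x, y)" "(x', y)" "(x', v)"] p q fib ab by (intro near) auto
        qed (use p q in auto)
        obtain S where S: "geodesic_segment ?U d (x', y) (x, y) S" using segs' by blast
        have "(d (x', y) (x, y))\<^sup>2 + (d (x', y) (x', y'))\<^sup>2 \<le> (1 + \<epsilon>') * ?D\<^sup>2"
        proof (rule thin_triangle_estimates(2)[OF U thin corners(2) corners(1) corners(4) _ S segs(5) \<gamma>(1-4)])
          show "small_perimeter k d (x', y) (x, y) (x', y')"
            using fib D' by (intro per) (simp add: commute[of "(x', y)" "(x, y)"] commute[of "(x', y')" "(x', y)"])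
          show "almost_flat_comparison k \<epsilon>' (d (x', y) (x, y)) ?D (d (x', y) (x', y'))"
            using fib D D' pos small by (intro \<rho>(2)) (auto simp: commute[of "(x', y)" "(x, y)"])
          show "\<forall>s\<in>{0..d (x', y) (x', y')}. d (x', y) (x, y) \<le> d (x, y) (\<gamma> s)"
          proof
            fix s assume s: "s \<in> {0..d (x', y) (x', y')}"
            then have "\<gamma> s \<in> X \<times> Y" "fst (\<gamma> s) = x'"
              using \<gamma>(1) \<gamma>(5)[of s] mball_subset_mspace by blast+
            then show "d (x', y) (x, y) \<le> d (x, y) (\<gamma> s)"
              using fst_short[of x y x' "snd (\<gamma> s)"] p q fib
              by (cases "\<gamma> s") (auto simp: a_def commute[of "(x', y)" "(x, y)"])
          qed
        qed
        then show ?thesis by (simp add: fib commute[of "(x', y)" "(x, y)"])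
      qed
      have lower_E: "a\<^sup>2 + b\<^sup>2 \<le> (1 + \<epsilon>') * ?E\<^sup>2"
      proof -
        obtain \<gamma> where \<gamma>: "\<gamma> ` {0..d (x, y) (x, y')} \<subseteq> ?U" "\<gamma> 0 = (x, y)" "\<gamma> (d (x, y) (x, y')) = (x, y')"
          "\<forall>s\<in>{0..d (x, y) (x, y')}. \<forall>t\<in>{0..d (x, y) (x, y')}. d (\<gamma> s) (\<gamma> t) = \<bar>s - t\<bar>"
          "\<And>s. s \<in> {0..d (x, y) (x, y')} \<Longrightarrow> fst (\<gamma> s) = x"
        proof (rule fibre_geodesic[OF mball_subset_mspace segs(2)])
          fix v assume v: "v \<in> Y" "d (x, y) (x, v) \<le> d (x, y) (x, y')"
          then show "(x, v) \<in> ?U" using p fib ab \<delta>(1) by (intro near) auto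
        qed (use p q in auto)
        have "(d (x, y) (x', y))\<^sup>2 + (d (x, y) (x, y'))\<^sup>2 \<le> (1 + \<epsilon>') * ?E\<^sup>2"
        proof (rule thin_triangle_estimates(2)[OF U thin corners(1,2,3) _ segs(1) segs(6) \<gamma>(1-4)])
          show "small_perimeter k d (x, y) (x', y) (x, y')"
            using fib E' by (intro per) (simp add: commute[of "(x, y')" "(x, y)"])
          show "almost_flat_comparison k \<epsilon>' (d (x, y) (x', y)) ?E (d (x, y) (x, y'))"
            using fib E E' pos small by (intro \<rho>(2)) auto
          show "\<forall>s\<in>{0..d (x, y) (x, y')}. d (x, y) (x', y) \<le> d (x', y) (\<gamma> s)"
          proof
            fix s assume s: "s \<in> {0..d (x, y) (x, y')}"
            then have "\<gamma> s \<in> X \<times> Y" "fst (\<gamma> s) = x"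
              using \<gamma>(1) \<gamma>(5)[of s] mball_subset_mspace by blast+
            then show "d (x, y) (x', y) \<le> d (x', y) (\<gamma> s)"
              using fst_short[of x "snd (\<gamma> s)" x' y] p q fib
              by (cases "\<gamma> s") (auto simp: a_def commute)
          qed
        qed
        then show ?thesis by (simp add: fib)
      qed
      have upper_D: "?D\<^sup>2 \<le> 2 * ((1 + \<epsilon>') * (a\<^sup>2 + b\<^sup>2)) - ?E\<^sup>2"
      proof -
        obtain \<gamma> where \<gamma>: "\<gamma> ` {0..?D} \<subseteq> ?U" "\<gamma> 0 = (x, y)" "\<gamma> ?D = (x', y')"
          "\<forall>s\<in>{0..?D}. \<forall>t\<in>{0..?D}. d (\<gamma> s) (\<gamma> t) = \<bar>s - t\<bar>"
          using segs(5) by (elim geodesic_segmentE) blast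
        define m where "m = \<gamma> (?D / 2)"
        have "?D / 2 \<in> {0..?D}" using pos by simp
        then have m: "m \<in> X \<times> Y" unfolding m_def using \<gamma>(1) mball_subset_mspace by blast
        have 1: "(d (x', y) m)\<^sup>2 \<le> (1 + \<epsilon>') * (a\<^sup>2 + b\<^sup>2) / 2 - ?D\<^sup>2 / 4"
          using thin_triangle_estimates(1)[OF U thin corners(1,2,4) _ segs(1) segs(3) \<gamma>, of \<epsilon>']
            per[of "(x, y)" "(x', y)" "(x', y')"] D D' pos small \<rho>(2)
          by (simp add: fib m_def commute[of "(x', y')" "(x, y)"])
        have 2: "(d (x, y') m)\<^sup>2 \<le> (1 + \<epsilon>') * (a\<^sup>2 + b\<^sup>2) / 2 - ?D\<^sup>2 / 4"
          using thin_triangle_estimates(1)[OF U thin corners(1,3,4) _ segs(2) segs(4) \<gamma>, of \<epsilon>']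
            per[of "(x, y)" "(x, y')" "(x', y')"] D D' pos small \<rho>(2)
          by (simp add: fib m_def commute[of "(x', y')" "(x, y)"] add.commute)
        have "?E \<le> d (x', y) m + d (x, y') m"
          using triangle[of "(x', y)" m "(x, y')"] m p q by (simp add: commute[of m])
        then have "?E\<^sup>2 \<le> (d (x', y) m + d (x, y') m)\<^sup>2"
          by (intro power_mono) auto
        also have "\<dots> \<le> 2 * (d (x', y) m)\<^sup>2 + 2 * (d (x, y') m)\<^sup>2"
          using zero_le_power2[of "d (x', y) m - d (x, y') m"] by (simp add: power2_sum power2_diff)
        finally show ?thesis using 1 2 by simp
      qed
      \<comment> \<open>\<open>lower_E\<close> is inverted without division, using (1 - \<epsilon>')
        * (1 + \<epsilon>') \<le> 1. In \<open>upper_D\<close> the coefficients then combine to 2 *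
        (1 + \<epsilon>') - (1 - \<epsilon>') = 1 + 3 * \<epsilon>'.\<close>
      have "(1 - \<epsilon>') * (a\<^sup>2 + b\<^sup>2) \<le> (1 - \<epsilon>'\<^sup>2) * ?E\<^sup>2" if "\<epsilon>' \<le> 1"
        using mult_left_mono[OF lower_E, of "1 - \<epsilon>'"] that
        by (simp add: algebra_simps power2_eq_square)
      then have "(1 - \<epsilon>') * (a\<^sup>2 + b\<^sup>2) \<le> ?E\<^sup>2"
      proof (cases "\<epsilon>' \<le> 1")
        case True
        have "(1 - \<epsilon>'\<^sup>2) * ?E\<^sup>2 \<le> 1 * ?E\<^sup>2" by (intro mult_right_mono) auto
        then show ?thesis using \<open>\<epsilon>' \<le> 1 \<Longrightarrow> _\<close>[OF True] by simp
      next
        case False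
        then have "(1 - \<epsilon>') * (a\<^sup>2 + b\<^sup>2) \<le> 0" by (simp add: mult_le_0_iff)
        then show ?thesis by (meson order_trans zero_le_power2)
      qed
      then have "?D\<^sup>2 \<le> (1 + 3 * \<epsilon>') * (a\<^sup>2 + b\<^sup>2)"
        using upper_D by (simp add: algebra_simps)
      moreover have "(1 + \<epsilon>') * ?D\<^sup>2 \<le> (1 + \<epsilon>) * ?D\<^sup>2"
        using \<epsilon> by (intro mult_right_mono) (auto simp: \<epsilon>'_def)
      ultimately show ?thesis
        using lower_D unfolding prod by (simp add: p q \<epsilon>'_def)
    qed
  qed
qed

end

section \<open>Length metrics that agree infinitesimally\<close>

lemma sum_steps_le_curve_length:
  assumes "\<And>i. i < n \<Longrightarrow> t i \<le> t (Suc i)" "\<And>i. i \<le> n \<Longrightarrow> t i \<in> {0..1}"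
  shows "ereal (\<Sum>i<n. d (\<gamma> (t i)) (\<gamma> (t (Suc i)))) \<le> curve_length d \<gamma>"
proof -
  have "mono_on {..n} t"
  proof (rule mono_onI)
    fix r s assume "s \<in> {..n}" and rs: "r \<le> s"
    then have "s \<le> n" by simp
    with rs show "t r \<le> t s"
    proof (induction s rule: dec_induct)
      case (step m)
      then show ?case using assms(1)[of m] by simp
    qed simp
  qed
  then show ?thesis
    unfolding curve_length_def by (intro SUP_upper2[of "(n, t)"]) (use assms(2) in auto)
qed

context Metric_space
begin

lemma continuous_on_dist_path:
  assumes "pathin mtopology \<gamma>" "a \<in> M"
  shows "continuous_on {0..1} (\<lambda>u. d a (\<gamma> u))"
proof -
  have "continuous_map (top_of_set {0..1}) mtopology \<gamma>"
    using assms(1) by (simp add: pathin_def)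
  moreover have "continuous_map mtopology euclideanreal (d a)"
    unfolding Metric_space.continuous_map_to_metric[OF Met_TC.Metric_space_axioms, unfolded mtopology_is_euclidean]
  proof (intro ballI allI impI)
    fix x and \<epsilon> :: real assume "x \<in> topspace mtopology" "0 < \<epsilon>"
    then show "\<exists>U. openin mtopology U \<and> x \<in> U \<and> (\<forall>y\<in>U. d a y \<in> Met_TC.mball (d a x) \<epsilon>)"
      using assms(2) mdist_reverse_triangle
      by (intro exI[of _ "mball x \<epsilon>"]) (auto simp: dist_real_def abs_less_iff; smt (verit) triangle commute)
  qed
  ultimately show ?thesis
    using continuous_map_compose[of "top_of_set {0..1}" mtopology \<gamma> euclideanreal "d a"]
    by (simp add: o_def)
qed

text \<open>
  By the intermediate value theorem one can walk along the curve in steps of distance exactly \<open>L / n\<close>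
  until the end is reached, which takes at most \<open>n\<close> steps. This replaces parametrization by arc length.
\<close>

lemma path_equal_steps:
  assumes \<gamma>: "pathin mtopology \<gamma>" and len: "curve_length d \<gamma> < ereal L" and n: "0 < n"
  obtains t :: "nat \<Rightarrow> real" where "t 0 = 0" "t n = 1" "\<And>i. t i \<in> {0..1}"
    "\<And>i. d (\<gamma> (t i)) (\<gamma> (t (Suc i))) \<le> L / n"
proof -
  have \<gamma>M: "\<gamma> u \<in> M" if "u \<in> {0..1}" for u
    using path_image_subset_topspace[OF \<gamma>] that by auto
  have L: "0 < L"
    using sum_steps_le_curve_length[of 0 "\<lambda>_. 0" d \<gamma>] len by (auto dest: le_less_trans)
  then have \<eta>: "0 < L / n" using n by simp
  \<comment> \<open>Once the parameter 1 is reached, monotonicity keeps the sequence there, so the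
    chain can always be read up to index n.\<close>
  have "\<exists>t. \<forall>i. (t i \<in> {0..1} \<and> (i = 0 \<longrightarrow> t i = 0)) \<and>
      (t i \<le> t (Suc i) \<and> d (\<gamma> (t i)) (\<gamma> (t (Suc i))) \<le> L / n \<and>
        (t (Suc i) = 1 \<or> d (\<gamma> (t i)) (\<gamma> (t (Suc i))) = L / n))"
  proof (rule dependent_nat_choice)
    fix s :: real and i :: nat
    assume "s \<in> {0..1} \<and> (i = 0 \<longrightarrow> s = 0)"
    then have s: "s \<in> {0..1}" by simp
    have cont: "continuous_on {s..1} (\<lambda>u. d (\<gamma> s) (\<gamma> u))"
      using continuous_on_dist_path[OF \<gamma> \<gamma>M[OF s]] by (rule continuous_on_subset) (use s in auto)
    show "\<exists>t. (t \<in> {0..1} \<and> (Suc i = 0 \<longrightarrow> t = 0)) \<and> (s \<le> t \<and> d (\<gamma> s) (\<gamma> t) \<le> L / n \<and>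
        (t = 1 \<or> d (\<gamma> s) (\<gamma> t) = L / n))"
    proof (cases "d (\<gamma> s) (\<gamma> 1) \<le> L / n")
      case True
      then show ?thesis using s by (intro exI[of _ 1]) auto
    next
      case False
      then obtain u where "s \<le> u" "u \<le> 1" "d (\<gamma> s) (\<gamma> u) = L / n"
        using IVT'[of "\<lambda>u. d (\<gamma> s) (\<gamma> u)" s "L / n" 1] cont s \<eta> \<gamma>M[OF s] by auto
      then show ?thesis using s by (intro exI[of _ u]) auto
    qed
  qed auto
  then obtain t where t': "\<forall>i. (t i \<in> {0..1} \<and> (i = 0 \<longrightarrow> t i = 0)) \<and>
      (t i \<le> t (Suc i) \<and> d (\<gamma> (t i)) (\<gamma> (t (Suc i))) \<le> L / n \<and>
        (t (Suc i) = 1 \<or> d (\<gamma> (t i)) (\<gamma> (t (Suc i))) = L / n))" by blast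
  have t: "t i \<in> {0..1}" "t 0 = 0" "t i \<le> t (Suc i)" "d (\<gamma> (t i)) (\<gamma> (t (Suc i))) \<le> L / n"
    "t (Suc i) = 1 \<or> d (\<gamma> (t i)) (\<gamma> (t (Suc i))) = L / n" for i
    using t' by blast+
  have mono: "t i \<le> t j" if "i \<le> j" for i j
    by (rule lift_Suc_mono_le[of t, OF _ that]) (rule t(3))
  \<comment> \<open>Otherwise no earlier parameter is 1 either, so the first n steps all have
    distance exactly L / n. They add up to L, against the strict bound on the length.\<close>
  have "t n = 1"
  proof (rule ccontr)
    assume "t n \<noteq> 1"
    then have "t n < 1" using t(1)[of n] by auto
    then have "t (Suc i) \<noteq> 1" if "i < n" for i
      using mono[of "Suc i" n] that by simp
    then have "(\<Sum>i<n. d (\<gamma> (t i)) (\<gamma> (t (Suc i)))) = (\<Sum>i<n. L / n)"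
      using t(5) by (intro sum.cong) auto
    also have "\<dots> = L" using n by simp
    finally show False
      using sum_steps_le_curve_length[of n t d \<gamma>] t(1,3) len by auto
  qed
  then show thesis using that[of t] t(1,2,4) by simp
qed

lemma length_space_path:
  assumes "length_space M d" "x \<in> M" "y \<in> M" "d x y < L"
  obtains \<gamma> where "pathin mtopology \<gamma>" "\<gamma> 0 = x" "\<gamma> 1 = y" "curve_length d \<gamma> < ereal L"
proof -
  have "(INF \<gamma> \<in> {\<gamma>. pathin mtopology \<gamma> \<and> \<gamma> 0 = x \<and> \<gamma> 1 = y}. curve_length d \<gamma>) < ereal L"
  proof -
    have eq: "ereal (d x y) = (INF \<gamma> \<in> {\<gamma>. pathin mtopology \<gamma> \<and> \<gamma> 0 = x \<and> \<gamma> 1 = y}. curve_length d \<gamma>)"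
      using assms(1-3) unfolding length_space_def by blast
    show ?thesis unfolding eq[symmetric] using assms(4) by simp
  qed
  then show thesis using that unfolding INF_less_iff by auto
qed

lemma chain_triangle:
  fixes z :: "nat \<Rightarrow> 'a"
  assumes "\<And>i. z i \<in> M"
  shows "d (z 0) (z n) \<le> (\<Sum>i<n. d (z i) (z (Suc i)))"
proof (induction n)
  case (Suc n)
  then show ?case using triangle[of "z 0" "z n" "z (Suc n)"] assms by simp
qed (use assms in simp)

text \<open>A Lebesgue number of the cover of K by the given balls. Only u has to lie in K.\<close>

lemma compactin_uniform_local:
  assumes K: "compactin mtopology K"
    and loc: "\<And>p. p \<in> K \<Longrightarrow> \<exists>\<delta>>0. \<forall>u\<in>mball p \<delta>. \<forall>v\<in>mball p \<delta>. Q u v"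
  shows "\<exists>\<delta>>0. \<forall>u\<in>K. \<forall>v\<in>M. d u v < \<delta> \<longrightarrow> Q u v"
proof -
  have KM: "K \<subseteq> M" using compactin_subset_topspace[OF K] by simp
  obtain \<delta> where \<delta>: "\<And>p. p \<in> K \<Longrightarrow> 0 < \<delta> p" "\<And>p. p \<in> K \<Longrightarrow> \<forall>u\<in>mball p (\<delta> p). \<forall>v\<in>mball p (\<delta> p). Q u v"
    using loc by metis
  have "\<exists>\<epsilon>>0. \<forall>x\<in>K. \<exists>U\<in>(\<lambda>p. mball p (\<delta> p)) ` K. mball x \<epsilon> \<subseteq> U"
    by (rule lebesgue_number[OF K]) (use \<delta>(1) KM in force)+
  then obtain \<epsilon> where \<epsilon>: "\<epsilon> > 0" "\<And>x. x \<in> K \<Longrightarrow> \<exists>p\<in>K. mball x \<epsilon> \<subseteq> mball p (\<delta> p)" by auto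
  show ?thesis
  proof (intro exI[of _ \<epsilon>] conjI ballI impI \<epsilon>(1))
    fix u v assume uv: "u \<in> K" "v \<in> M" "d u v < \<epsilon>"
    then obtain p where p: "p \<in> K" "mball u \<epsilon> \<subseteq> mball p (\<delta> p)" using \<epsilon>(2) by blast
    have "u \<in> mball u \<epsilon>" "v \<in> mball u \<epsilon>" using uv KM \<epsilon>(1) by auto
    then show "Q u v" using p \<delta>(2) by blast
  qed
qed

text \<open>A \<open>d\<close>-curve of length below L is cut into n steps of
  \<open>d\<close>-distance at most L / n, below the uniform radius on its compact image. Each step
  costs at most (1 + \<epsilon>) * (L / n) in e, so the total does not depend on n.\<close>

lemma length_space_le_if_locally_almost_le:
  assumes len: "length_space M d" and e: "Metric_space M e"
    and loc: "\<And>p \<epsilon>. \<lbrakk>p \<in> M; 0 < \<epsilon>\<rbrakk> \<Longrightarrow> \<exists>\<delta>>0. \<forall>u\<in>mball p \<delta>. \<forall>v\<in>mball p \<delta>. e u v \<le> (1 + \<epsilon>) * d u v"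
    and xy: "x \<in> M" "y \<in> M"
  shows "e x y \<le> d x y"
proof (rule dense_ge)
  interpret e: Metric_space M e by fact
  fix L assume L: "d x y < L"
  then have L0: "0 < L" using nonneg[of x y] by linarith
  obtain \<gamma> where \<gamma>: "pathin mtopology \<gamma>" "\<gamma> 0 = x" "\<gamma> 1 = y" "curve_length d \<gamma> < ereal L"
    using length_space_path[OF len xy L] by metis
  have \<gamma>M: "\<gamma> u \<in> M" if "u \<in> {0..1}" for u
    using path_image_subset_topspace[OF \<gamma>(1)] that by auto
  have K: "compactin mtopology (\<gamma> ` {0..1})"
    using \<gamma>(1) unfolding pathin_def by (rule image_compactin[rotated]) (simp add: compactin_subtopology)
  have est: "e x y \<le> L + L * \<epsilon>" if \<epsilon>: "0 < \<epsilon>" for \<epsilon>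
  proof -
    have "\<exists>\<delta>>0. \<forall>u\<in>\<gamma> ` {0..1}. \<forall>v\<in>M. d u v < \<delta> \<longrightarrow> e u v \<le> (1 + \<epsilon>) * d u v"
    proof (rule compactin_uniform_local[OF K])
      fix p assume "p \<in> \<gamma> ` {0..1}"
      then have "p \<in> M" using \<gamma>M by auto
      then show "\<exists>\<delta>>0. \<forall>u\<in>mball p \<delta>. \<forall>v\<in>mball p \<delta>. e u v \<le> (1 + \<epsilon>) * d u v"
        by (rule loc[OF _ \<epsilon>])
    qed
    then obtain \<delta> where \<delta>: "0 < \<delta>"
      "\<forall>u\<in>\<gamma> ` {0..1}. \<forall>v\<in>M. d u v < \<delta> \<longrightarrow> e u v \<le> (1 + \<epsilon>) * d u v" by blast
    obtain n :: nat where n: "0 < n" "L / n < \<delta>"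
      using ex_inverse_of_nat_less[of "\<delta> / L"] \<delta>(1) L0 by (auto simp: field_simps)
    obtain t where t: "t 0 = 0" "t n = 1" "\<And>i. t i \<in> {0..1}" "\<And>i. d (\<gamma> (t i)) (\<gamma> (t (Suc i))) \<le> L / n"
      using path_equal_steps[OF \<gamma>(1,4) n(1)] by metis
    have "e x y \<le> (\<Sum>i<n. e (\<gamma> (t i)) (\<gamma> (t (Suc i))))"
      using e.chain_triangle[of "\<lambda>i. \<gamma> (t i)" n] \<gamma>M t by (simp add: \<gamma>)
    also have "\<dots> \<le> (\<Sum>i<n. (1 + \<epsilon>) * (L / n))"
    proof (rule sum_mono)
      fix i
      have "e (\<gamma> (t i)) (\<gamma> (t (Suc i))) \<le> (1 + \<epsilon>) * d (\<gamma> (t i)) (\<gamma> (t (Suc i)))"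
        using \<delta>(2) t(3)[of i] t(3)[of "Suc i"] le_less_trans[OF t(4)[of i] n(2)] \<gamma>M by blast
      also have "\<dots> \<le> (1 + \<epsilon>) * (L / n)" using t(4)[of i] \<epsilon> by (intro mult_left_mono) auto
      finally show "e (\<gamma> (t i)) (\<gamma> (t (Suc i))) \<le> (1 + \<epsilon>) * (L / n)" .
    qed
    also have "\<dots> = L + L * \<epsilon>" using n by (simp add: field_simps)
    finally show ?thesis .
  qed
  show "e x y \<le> L"
  proof (rule field_le_epsilon)
    fix \<zeta> :: real assume "0 < \<zeta>"
    then show "e x y \<le> L + \<zeta>" using est[of "\<zeta> / L"] L0 by simp
  qed
qed

end

context Metric_space12
begin

text \<open>Curves in the two factors are walked in the same number n of equal steps. Each
  simultaneous step then has product length at most L / n, where L is the hypotenuse of the two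
  lengths, so the chain is nearly straight for the product metric.\<close>

lemma le_prod_dist_if_locally_almost_le:
  assumes len: "length_space M1 d1" "length_space M2 d2" and e: "Metric_space (M1 \<times> M2) e"
    and loc: "\<And>p \<epsilon>. \<lbrakk>p \<in> M1 \<times> M2; 0 < \<epsilon>\<rbrakk> \<Longrightarrow>
      \<exists>\<delta>>0. \<forall>u\<in>Prod_metric.mball p \<delta>. \<forall>v\<in>Prod_metric.mball p \<delta>. e u v \<le> (1 + \<epsilon>) * prod_dist d1 d2 u v"
    and xy: "x \<in> M1" "y \<in> M2" "x' \<in> M1" "y' \<in> M2"
  shows "e (x, y) (x', y') \<le> prod_dist d1 d2 (x, y) (x', y')"
proof (rule field_le_epsilon)
  interpret e: Metric_space "M1 \<times> M2" e by fact
  fix \<eta> :: real assume \<eta>: "0 < \<eta>"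
  \<comment> \<open>The slack yields curves strictly shorter than L1 and L2 and keeps both positive
    if endpoints coincide. By the triangle inequality in the plane it costs at most \<eta> in
    L.\<close>
  define L1 L2 where "L1 = d1 x x' + \<eta> / 2" and "L2 = d2 y y' + \<eta> / 2"
  define L where "L = sqrt (L1\<^sup>2 + L2\<^sup>2)"
  have L12: "0 < L1" "0 < L2" "d1 x x' < L1" "d2 y y' < L2" using \<eta> by (auto simp: L1_def L2_def add_nonneg_pos)
  have L0: "0 < L" using L12 by (simp add: L_def sum_power2_gt_zero_iff)
  obtain \<alpha> where \<alpha>: "pathin M1.mtopology \<alpha>" "\<alpha> 0 = x" "\<alpha> 1 = x'" "curve_length d1 \<alpha> < ereal L1"
    using M1.length_space_path[OF len(1) xy(1,3) L12(3)] by metis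
  obtain \<beta> where \<beta>: "pathin M2.mtopology \<beta>" "\<beta> 0 = y" "\<beta> 1 = y'" "curve_length d2 \<beta> < ereal L2"
    using M2.length_space_path[OF len(2) xy(2,4) L12(4)] by metis
  have \<alpha>M: "\<alpha> u \<in> M1" and \<beta>M: "\<beta> u \<in> M2" if "u \<in> {0..1}" for u
    using path_image_subset_topspace[OF \<alpha>(1)] path_image_subset_topspace[OF \<beta>(1)] that by auto
  have "compactin M1.mtopology (\<alpha> ` {0..1})"
    using \<alpha>(1) unfolding pathin_def by (rule image_compactin[rotated]) (simp add: compactin_subtopology)
  moreover have "compactin M2.mtopology (\<beta> ` {0..1})"
    using \<beta>(1) unfolding pathin_def by (rule image_compactin[rotated]) (simp add: compactin_subtopology)
  \<comment> \<open>The chain pairs points of the two curves at different parameters, so uniformity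
    is needed on the whole product of their images.\<close>
  ultimately have K: "compactin Prod_metric.mtopology (\<alpha> ` {0..1} \<times> \<beta> ` {0..1})"
    by (simp add: mtopology_prod_metric compactin_Times)
  have est: "e (x, y) (x', y') \<le> L + L * \<epsilon>" if \<epsilon>: "0 < \<epsilon>" for \<epsilon>
  proof -
    have "\<exists>\<delta>>0. \<forall>u\<in>\<alpha> ` {0..1} \<times> \<beta> ` {0..1}. \<forall>v\<in>M1 \<times> M2.
        prod_dist d1 d2 u v < \<delta> \<longrightarrow> e u v \<le> (1 + \<epsilon>) * prod_dist d1 d2 u v"
    proof (rule Prod_metric.compactin_uniform_local[OF K])
      fix p assume "p \<in> \<alpha> ` {0..1} \<times> \<beta> ` {0..1}"
      then have "p \<in> M1 \<times> M2" using \<alpha>M \<beta>M by auto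
      then show "\<exists>\<delta>>0. \<forall>u\<in>Prod_metric.mball p \<delta>. \<forall>v\<in>Prod_metric.mball p \<delta>. e u v \<le> (1 + \<epsilon>) * prod_dist d1 d2 u v"
        by (rule loc[OF _ \<epsilon>])
    qed
    then obtain \<delta> where \<delta>: "0 < \<delta>" "\<forall>u\<in>\<alpha> ` {0..1} \<times> \<beta> ` {0..1}. \<forall>v\<in>M1 \<times> M2.
        prod_dist d1 d2 u v < \<delta> \<longrightarrow> e u v \<le> (1 + \<epsilon>) * prod_dist d1 d2 u v" by blast
    obtain n :: nat where n: "0 < n" "L / n < \<delta>"
      using ex_inverse_of_nat_less[of "\<delta> / L"] \<delta>(1) L0 by (auto simp: field_simps)
    obtain s where s: "s 0 = 0" "s n = 1" "\<And>i. s i \<in> {0..1}" "\<And>i. d1 (\<alpha> (s i)) (\<alpha> (s (Suc i))) \<le> L1 / n"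
      using M1.path_equal_steps[OF \<alpha>(1,4) n(1)] by metis
    obtain t where t: "t 0 = 0" "t n = 1" "\<And>i. t i \<in> {0..1}" "\<And>i. d2 (\<beta> (t i)) (\<beta> (t (Suc i))) \<le> L2 / n"
      using M2.path_equal_steps[OF \<beta>(1,4) n(1)] by metis
    define z where "z i = (\<alpha> (s i), \<beta> (t i))" for i
    have zK: "z i \<in> \<alpha> ` {0..1} \<times> \<beta> ` {0..1}" and zM: "z i \<in> M1 \<times> M2" for i
      using s(3)[of i] t(3)[of i] \<alpha>M \<beta>M by (auto simp: z_def)
    have step: "prod_dist d1 d2 (z i) (z (Suc i)) \<le> L / n" for i
    proof -
      have "prod_dist d1 d2 (z i) (z (Suc i)) \<le> sqrt ((L1 / n)\<^sup>2 + (L2 / n)\<^sup>2)"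
        unfolding prod_dist_def z_def using s(4)[of i] t(4)[of i]
        by (auto intro!: add_mono power_mono)
      also have "\<dots> = sqrt ((L1\<^sup>2 + L2\<^sup>2) / (real n)\<^sup>2)"
        by (simp add: power_divide add_divide_distrib)
      also have "\<dots> = L / n" by (simp add: L_def real_sqrt_divide)
      finally show ?thesis .
    qed
    have "e (x, y) (x', y') \<le> (\<Sum>i<n. e (z i) (z (Suc i)))"
      using e.chain_triangle[of z n] zM by (simp add: z_def s t \<alpha> \<beta>)
    also have "\<dots> \<le> (\<Sum>i<n. (1 + \<epsilon>) * (L / n))"
    proof (rule sum_mono)
      fix i
      have "e (z i) (z (Suc i)) \<le> (1 + \<epsilon>) * prod_dist d1 d2 (z i) (z (Suc i))"
        by (rule \<delta>(2)[rule_format, OF zK zM le_less_trans[OF step n(2)]])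
      also have "\<dots> \<le> (1 + \<epsilon>) * (L / n)" using step[of i] \<epsilon> by (intro mult_left_mono) auto
      finally show "e (z i) (z (Suc i)) \<le> (1 + \<epsilon>) * (L / n)" .
    qed
    also have "\<dots> = L + L * \<epsilon>" using n by (simp add: field_simps)
    finally show ?thesis .
  qed
  have "e (x, y) (x', y') \<le> L"
  proof (rule field_le_epsilon)
    fix \<zeta> :: real assume "0 < \<zeta>"
    then show "e (x, y) (x', y') \<le> L + \<zeta>" using est[of "\<zeta> / L"] L0 by simp
  qed
  also have "L \<le> sqrt ((d1 x x')\<^sup>2 + (d2 y y')\<^sup>2) + sqrt ((\<eta> / 2)\<^sup>2 + (\<eta> / 2)\<^sup>2)"
    unfolding L_def L1_def L2_def by (rule real_sqrt_sum_squares_triangle_ineq)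
  also have "sqrt ((\<eta> / 2)\<^sup>2 + (\<eta> / 2)\<^sup>2) \<le> \<eta>"
    using sqrt_sum_squares_le_sum[of "\<eta>/2" "\<eta>/2"] \<eta> by simp
  finally show "e (x, y) (x', y') \<le> prod_dist d1 d2 (x, y) (x', y') + \<eta>"
    by (simp add: prod_dist_def)
qed

end

section \<open>Recognition of the product metric\<close>

lemma submetry_short:
  assumes "submetry M d B dB f" "Metric_space M d" "Metric_space B dB" "p \<in> M" "q \<in> M"
  shows "dB (f p) (f q) \<le> d p q"
proof -
  interpret M: Metric_space M d by fact
  interpret B: Metric_space B dB by fact
  show ?thesis
  \<comment> \<open>The ball of radius \<open>d p q\<close> about p can be used only for p \<noteq>
    q, since \<open>submetry\<close> speaks of positive radii.\<close>
  proof (cases "p = q")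
    case True
    then show ?thesis using assms by (auto simp: submetry_def)
  next
    case False
    then have "0 < d p q" using assms by simp
    then have "f ` M.mcball p (d p q) = B.mcball (f p) (d p q)"
      using assms by (auto simp: submetry_def)
    moreover have "q \<in> M.mcball p (d p q)" using assms by simp
    ultimately have "f q \<in> B.mcball (f p) (d p q)" by blast
    then show ?thesis by simp
  qed
qed

lemma (in Metric_space12) prod_dist_fibre:
  assumes "x \<in> M1" "y \<in> M2" "x' \<in> M1" "y' \<in> M2"
  shows "prod_dist d1 d2 (x, y) (x', y) = d1 x x'" "prod_dist d1 d2 (x, y) (x, y') = d2 y y'"
  using assms by (simp_all add: prod_dist_def)

lemma (in Metric_space12) prod_dist_projections:
  assumes "Metric_space (M1 \<times> M2) d"
    and eq: "\<And>p q. \<lbrakk>p \<in> M1 \<times> M2; q \<in> M1 \<times> M2\<rbrakk> \<Longrightarrow> d p q = prod_dist d1 d2 p q"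
  shows "submetry (M1 \<times> M2) d M1 d1 fst" "submetry (M1 \<times> M2) d M2 d2 snd"
    and "y \<in> M2 \<Longrightarrow> isometry {p \<in> M1 \<times> M2. snd p = y} d M1 d1 fst"
    and "x \<in> M1 \<Longrightarrow> isometry {p \<in> M1 \<times> M2. fst p = x} d M2 d2 snd"
proof -
  interpret d: Metric_space "M1 \<times> M2" d by fact
  have short: "d1 x x' \<le> d (x, y) (x', y')" "d2 y y' \<le> d (x, y) (x', y')"
    if "x \<in> M1" "y \<in> M2" "x' \<in> M1" "y' \<in> M2" for x y x' y'
    using that component_le_prod_metric by (simp_all add: eq)
  have fibre: "d (x, y) (x', y) = d1 x x'" "d (x, y) (x, y') = d2 y y'"
    if "x \<in> M1" "y \<in> M2" "x' \<in> M1" "y' \<in> M2" for x y x' y'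
    using that by (simp_all add: eq prod_dist_fibre)
  show "submetry (M1 \<times> M2) d M1 d1 fst"
    unfolding submetry_def
  proof (intro conjI ballI allI impI)
    fix p and r :: real assume "p \<in> M1 \<times> M2" "0 < r"
    then obtain x y where p: "p = (x, y)" "x \<in> M1" "y \<in> M2" by auto
    show "fst ` d.mcball p r = M1.mcball (fst p) r"
    proof (intro equalityI subsetI)
      fix x' assume "x' \<in> fst ` d.mcball p r"
      then show "x' \<in> M1.mcball (fst p) r"
        using p by (auto intro: order_trans[OF short(1)])
    next
      fix x' assume "x' \<in> M1.mcball (fst p) r"
      \<comment> \<open>\<open>x'\<close> is lifted at constant second coordinate, where the
        projection preserves distances.\<close>
      then have "(x', y) \<in> d.mcball p r" using p by (simp add: fibre)
      then show "x' \<in> fst ` d.mcball p r" by force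
    qed
  qed auto
  show "submetry (M1 \<times> M2) d M2 d2 snd"
    unfolding submetry_def
  proof (intro conjI ballI allI impI)
    fix p and r :: real assume "p \<in> M1 \<times> M2" "0 < r"
    then obtain x y where p: "p = (x, y)" "x \<in> M1" "y \<in> M2" by auto
    show "snd ` d.mcball p r = M2.mcball (snd p) r"
    proof (intro equalityI subsetI)
      fix y' assume "y' \<in> snd ` d.mcball p r"
      then show "y' \<in> M2.mcball (snd p) r"
        using p by (auto intro: order_trans[OF short(2)])
    next
      fix y' assume "y' \<in> M2.mcball (snd p) r"
      then have "(x, y') \<in> d.mcball p r" using p by (simp add: fibre)
      then show "y' \<in> snd ` d.mcball p r" by force
    qed
  qed auto
  show "isometry {p \<in> M1 \<times> M2. snd p = y} d M1 d1 fst" if "y \<in> M2"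
    using that by (auto simp: isometry_def bij_betw_def inj_on_def fibre image_iff)
  show "isometry {p \<in> M1 \<times> M2. fst p = x} d M2 d2 snd" if "x \<in> M1"
    using that by (auto simp: isometry_def bij_betw_def inj_on_def fibre image_iff)
qed

lemma (in orthogonal_fibres) dist_eq_prod_dist:
  assumes X: "length_space X dX" and Y: "length_space Y dY" and curv: "curvature_le k (X \<times> Y) d"
    and "p \<in> X \<times> Y" "q \<in> X \<times> Y"
  shows "d p q = prod_dist dX dY p q"
proof (rule antisym)
  interpret Metric_space12 X dX Y dY
    using X Y by (simp add: Metric_space12_def length_space_def)
  have loc: "\<exists>\<delta>>0. \<forall>u\<in>mball p \<delta>. \<forall>v\<in>mball p \<delta>.
      d u v \<le> (1 + \<epsilon>) * prod_dist dX dY u v \<and> prod_dist dX dY u v \<le> (1 + \<epsilon>) * d u v"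
    if p: "p \<in> X \<times> Y" and \<epsilon>: "0 < \<epsilon>" for p \<epsilon>
  proof -
    have "\<forall>p\<in>X \<times> Y. \<exists>r>0. CAT k (mball p r) d"
      using curv by (simp add: curvature_le_def)
    from bspec[OF this p] obtain r where r: "0 < r" "CAT k (mball p r) d" by blast
    obtain \<delta> where \<delta>: "0 < \<delta>" "\<And>u v. \<lbrakk>u \<in> mball p \<delta>; v \<in> mball p \<delta>\<rbrakk> \<Longrightarrow>
        (d u v)\<^sup>2 \<le> (1 + \<epsilon>) * (prod_dist dX dY u v)\<^sup>2 \<and> (prod_dist dX dY u v)\<^sup>2 \<le> (1 + \<epsilon>) * (d u v)\<^sup>2"
      using locally_almost_product[OF r(2,1) p \<epsilon>] by blast
    \<comment> \<open>The root of 1 + \<epsilon> is at most 1 + \<epsilon>, so the same \<epsilon>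
      serves after removing the squares.\<close>
    have sq: "s \<le> (1 + \<epsilon>) * t" if "s\<^sup>2 \<le> (1 + \<epsilon>) * t\<^sup>2" "0 \<le> t" for s t :: real
    proof (rule power2_le_imp_le)
      have "(1 + \<epsilon>) * t\<^sup>2 \<le> (1 + \<epsilon>)\<^sup>2 * t\<^sup>2"
        using \<epsilon> by (intro mult_right_mono) (auto simp: power2_eq_square)
      then show "s\<^sup>2 \<le> ((1 + \<epsilon>) * t)\<^sup>2" using that by (simp add: power_mult_distrib)
    qed (use \<epsilon> that in simp)
    show ?thesis
    proof (intro exI[of _ \<delta>] conjI ballI \<delta>(1))
      fix u v assume uv: "u \<in> mball p \<delta>" "v \<in> mball p \<delta>"
      note est = \<delta>(2)[OF uv]
      show "d u v \<le> (1 + \<epsilon>) * prod_dist dX dY u v"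
        using conjunct1[OF est] Prod_metric.nonneg by (rule sq)
      show "prod_dist dX dY u v \<le> (1 + \<epsilon>) * d u v"
        using conjunct2[OF est] nonneg by (rule sq)
    qed
  qed
  obtain x y x' y' where pq: "p = (x, y)" "q = (x', y')" "x \<in> X" "y \<in> Y" "x' \<in> X" "y' \<in> Y"
    using assms by auto
  show "prod_dist dX dY p q \<le> d p q"
  proof (rule length_space_le_if_locally_almost_le)
    show "length_space (X \<times> Y) d" using curv by (simp add: curvature_le_def)
    show "Metric_space (X \<times> Y) (prod_dist dX dY)" by (rule prod_metric)
    show "\<exists>\<delta>>0. \<forall>u\<in>mball p \<delta>. \<forall>v\<in>mball p \<delta>. prod_dist dX dY u v \<le> (1 + \<epsilon>) * d u v"
      if "p \<in> X \<times> Y" "0 < \<epsilon>" for p \<epsilon>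
      using loc[OF that] by blast
  qed (use assms in auto)
  \<comment> \<open>\<open>loc\<close> gives its estimate on balls of \<open>d\<close>, but the
    chain argument needs balls of the product metric. This crude bound, obtained by moving in one
    factor after the other, puts a product ball of half the radius inside a ball of
    \<open>d\<close>.\<close>
  have d_le: "d u v \<le> 2 * prod_dist dX dY u v" if uv: "u \<in> X \<times> Y" "v \<in> X \<times> Y" for u v
  proof -
    obtain a b a' b' where ab: "u = (a, b)" "v = (a', b')" "a \<in> X" "b \<in> Y" "a' \<in> X" "b' \<in> Y"
      using uv by auto
    have "d u v \<le> dX a a' + dY b b'"
      using triangle[of "(a, b)" "(a', b)" "(a', b')"] ab by (simp add: fst_fibre snd_fibre)
    also have "\<dots> \<le> 2 * prod_dist dX dY u v"
      using component_le_prod_metric(1)[of a a' b b']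
        component_le_prod_metric(2)[of b b' a a'] ab by simp
    finally show ?thesis .
  qed
  show "d p q \<le> prod_dist dX dY p q"
    unfolding pq(1,2)
  proof (rule le_prod_dist_if_locally_almost_le[OF X Y])
    fix p \<epsilon> assume p: "p \<in> X \<times> Y" and \<epsilon>: "0 < (\<epsilon> :: real)"
    obtain \<delta> where \<delta>: "0 < \<delta>"
      "\<And>u v. u \<in> mball p \<delta> \<Longrightarrow> v \<in> mball p \<delta> \<Longrightarrow> d u v \<le> (1 + \<epsilon>) * prod_dist dX dY u v"
      using loc[OF p \<epsilon>] by blast
    have "u \<in> mball p \<delta>" if "u \<in> Prod_metric.mball p (\<delta> / 2)" for u
      using d_le[of p u] that unfolding in_mball Prod_metric.in_mball by linarith
    then show "\<exists>\<delta>>0. \<forall>u\<in>Prod_metric.mball p \<delta>. \<forall>v\<in>Prod_metric.mball p \<delta>.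
        d u v \<le> (1 + \<epsilon>) * prod_dist dX dY u v"
      using \<delta> by (intro exI[of _ "\<delta> / 2"]) auto
  qed (use pq Metric_space_axioms in auto)
qed

theorem proposition6:
  fixes X :: "'a set" and Y :: "'b set"
    and dX :: "'a \<Rightarrow> 'a \<Rightarrow> real" and dY :: "'b \<Rightarrow> 'b \<Rightarrow> real"
    and d :: "'a \<times> 'b \<Rightarrow> 'a \<times> 'b \<Rightarrow> real"
  assumes "length_space X dX" and "length_space Y dY"
    and "Metric_space (X \<times> Y) d"
    and "finite_dimensional (X \<times> Y) d"
    and "curvature_bounded_above (X \<times> Y) d"
    and "curvature_bounded_below (X \<times> Y) d"
  shows "(\<forall>p\<in>X \<times> Y. \<forall>q\<in>X \<times> Y. d p q = prod_dist dX dY p q) \<longleftrightarrow>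
    submetry (X \<times> Y) d X dX fst \<and> submetry (X \<times> Y) d Y dY snd \<and>
    (\<forall>x\<in>X. \<forall>y\<in>Y.
       isometry {p \<in> X \<times> Y. snd p = snd (x, y)} d X dX fst \<and>
       isometry {p \<in> X \<times> Y. fst p = fst (x, y)} d Y dY snd)"
    (is "?product \<longleftrightarrow> ?projections")
proof
  have M: "Metric_space X dX" "Metric_space Y dY"
    using assms(1,2) by (auto simp: length_space_def)
  interpret Metric_space12 X dX Y dY
    using M by (simp add: Metric_space12_def)
  show ?projections if ?product
    using prod_dist_projections[OF assms(3)] that by auto
  show ?product if proj: ?projections
  proof -
    interpret orthogonal_fibres X Y d dX dY
    proof (intro orthogonal_fibres.intro assms(3) orthogonal_fibres_axioms.intro)
      fix x y x' y' assume xy: "x \<in> X" "y \<in> Y" "x' \<in> X" "y' \<in> Y"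
      show "dX x x' \<le> d (x, y) (x', y')"
        using submetry_short[OF _ assms(3) M(1), of fst "(x, y)" "(x', y')"] proj xy by simp
      show "dY y y' \<le> d (x, y) (x', y')"
        using submetry_short[OF _ assms(3) M(2), of snd "(x, y)" "(x', y')"] proj xy by simp
    next
      fix x y x' assume "x \<in> X" "y \<in> Y" "x' \<in> X"
      then show "d (x, y) (x', y) = dX x x'"
        using proj by (auto simp: isometry_def)
    next
      fix x y y' assume "x \<in> X" "y \<in> Y" "y' \<in> Y"
      then show "d (x, y) (x, y') = dY y y'"
        using proj by (auto simp: isometry_def)
    qed
    obtain k where "curvature_le k (X \<times> Y) d"
      using assms(5) by (auto simp: curvature_bounded_above_def)
    then show ?thesis
      using dist_eq_prod_dist[OF assms(1,2)] by blast
  qed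
qed

end
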